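(* For almost all data sequences $(N(T),T)_{[1:\infty]}$, all $R>0$ and all $\epsilon>0$ it holds that $$\mathbb{P}\Big(\sup_{z\in[0,R]}|\hat g_n(z)-g_0(z)|\ge\epsilon\ \Big|\ (N(T),T)_{[1:n]}\Big)\longrightarrow 0\qquad(n\to\infty).$$
   Context: True parameters (stable M/G/1 queue): $\lambda_0>0$ is the true arrival (equivalently departure) rate, $G_0$ the true service time distribution on $\mathbb{R}_+$ with $\rho_0=\lambda_0\int t\,G_0(dt)<1$, and $g_0(z)=\int_0^\infty e^{-zs}\,G_0(ds)$ its Laplace–Stieltjes transform. The number $A_S$ of arrivals during a service has true law $A_0(\{k\})=\frac1{k!}\int_0^\infty e^{-\lambda_0t}(\lambda_0t)^kG_0(dt)$, $k\in\mathbb{N}_0$, with probability generating function $a_0(z)=\sum_k z^kA_0(\{k\})$, so that $g_0(z)=a_0(1-z/\lambda_0)$. Data: $T_n$ is the departure time of the $n$-th customer and $X_n=N(T_n)$ the number of customers left behind; $(N(T),T)_{[1:n]}$ denotes $(N(T_i),T_i)_{i\le n}$. The data model is: the interdeparture times $D_i=T_{i+1}-T_i$ are i.i.d. exponential with rate $\lambda_0$, and $(X_n)$ is the stationary Markov chain with transition matrix $M_0$, where row $0$ of $M_0$ is $(A_0(\{k\}))_{k\ge0}$ and row $i\ge1$ is row $0$ shifted $i-1$ places to the right and filled with zeros. "Almost all" refers to the true law of the data. Priors and posteriors: $\lambda\sim\Gamma(a,b)$ (shape $a>0$, rate $b>0$), with posterior $\Gamma(a+n,b+\sum_{i=1}^nD_i)$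 and posterior mean $\bar\lambda_n=\frac{a+n}{b+\sum_{i=1}^nD_i}$. Independently, the law $A$ of $A_S$ (row $0$ of the random transition matrix $M$, whose row $i\ge1$ is row $0$ shifted $i-1$ places to the right) has a Dirichlet process prior on $\mathbb{N}_0$ with base measure $\alpha c_0$, where $\alpha>0$ and $c_0$ is a probability measure on $\mathbb{N}_0$; its posterior is the Dirichlet process with base measure $c_n(\{k\})=\alpha c_0(\{k\})+\sum_{i=1}^{n-1}\delta_{X_{i+1}-X_i+(1-\delta_{X_i0})}(\{k\})$ (here $\delta_{X_i0}=1$ if $X_i=0$ and $0$ otherwise). Put $\bar c_n(\{k\})=c_n(\{k\})/(\alpha+n-1)$ and $\gamma_n(z)=\sum_{k\ge0}z^k\bar c_n(\{k\})$. The plug-in estimator is $\hat g_n(z)=\gamma_n(1-z/\bar\lambda_n)$. $\mathbb{P}(\cdot\mid(N(T),T)_{[1:n]})$ denotes conditional (posterior) probability given the data.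
   Formalization: As stated false for large R: γ_n(1-z/λ̄_n) may diverge or fail to converge once the argument is below -1. Proved with sup over [0,R] for R<λ_0(1+s), s≥1 where the generating functions of c_0 and A_0 converge (s=1 always); for other R, over z in [0,R] with |1-z/λ̄_n|≤s. *)

theory Defs
  imports "HOL-Probability.Probability"
begin

section \<open>The M/G/1 queue observed at departures\<close>

definition laplace_stieltjes :: "real measure \<Rightarrow> real \<Rightarrow> real" where
  "laplace_stieltjes G z = (LINT s|G. exp (- (z * s)))"

definition arrivals_law :: "real \<Rightarrow> real measure \<Rightarrow> nat \<Rightarrow> real" where
  "arrivals_law l G k = (1 / fact k) * (LINT t|G. exp (- (l * t)) * (l * t) ^ k)"

definition transition_matrix :: "(nat \<Rightarrow> real) \<Rightarrow> nat \<Rightarrow> nat \<Rightarrow> real" where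
  "transition_matrix p i j =
     (if i = 0 then p j else if i - 1 \<le> j then p (j - (i - 1)) else 0)"

text \<open>The chain is indexed by \<open>1, 2, \<dots>\<close>; the value at index \<open>0\<close> plays no role.\<close>

definition stationary_markov_chain ::
    "'w measure \<Rightarrow> (nat \<Rightarrow> 'w \<Rightarrow> nat) \<Rightarrow> (nat \<Rightarrow> nat \<Rightarrow> real) \<Rightarrow> bool" where
  "stationary_markov_chain P X K \<longleftrightarrow>
     (\<forall>i\<ge>1. X i \<in> measurable P (count_space UNIV)) \<and>
     (\<forall>n\<ge>1. \<forall>x. \<P>(\<omega> in P. \<forall>i\<in>{1..n+1}. X i \<omega> = x i)
        = \<P>(\<omega> in P. \<forall>i\<in>{1..n}. X i \<omega> = x i) * K (x n) (x (n+1))) \<and>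
     (\<forall>n\<ge>1. \<forall>j. \<P>(\<omega> in P. X n \<omega> = j) = \<P>(\<omega> in P. X 1 \<omega> = j))"

section \<open>Gamma law and Dirichlet process\<close>

text \<open>Shape \<open>a\<close> and rate \<open>b\<close>. Shape \<open>0\<close> is the point mass at \<open>0\<close>, the usual convention
  that lets Dirichlet distributions have vanishing parameters.\<close>

definition gamma_law :: "real \<Rightarrow> real \<Rightarrow> real measure" where
  "gamma_law a b =
     (if a = 0 then return borel 0
      else density lborel (\<lambda>x. ennreal
        (if x \<le> 0 then 0 else b powr a / Gamma a * x powr (a - 1) * exp (- (b * x)))))"

text \<open>Law of the normalised vector of independent Gamma variables with shapes
  \<open>v 0, \<dots>, v (m - 1)\<close>.\<close>

definition dirichlet_law :: "nat \<Rightarrow> (nat \<Rightarrow> real) \<Rightarrow> (nat \<Rightarrow> real) measure" where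
  "dirichlet_law m v =
     distr (\<Pi>\<^sub>M j\<in>{..<m}. gamma_law (v j) 1) (\<Pi>\<^sub>M j\<in>{..<m}. borel)
       (\<lambda>y. \<lambda>j\<in>{..<m}. y j / (\<Sum>i<m. y i))"

text \<open>Ferguson's definition, for the base measure on the naturals with point masses \<open>c k\<close>:
  a law on the space of probability measures on the naturals whose evaluations on every finite
  partition are Dirichlet distributed.\<close>

definition is_dirichlet_process :: "(nat \<Rightarrow> real) \<Rightarrow> nat measure measure \<Rightarrow> bool" where
  "is_dirichlet_process c Q \<longleftrightarrow>
     prob_space Q \<and> sets Q = sets (prob_algebra (count_space UNIV)) \<and>
     (\<forall>m B. disjoint_family_on B {..<m} \<and> (\<Union>j<m. B j) = UNIV \<longrightarrow>
        distr Q (\<Pi>\<^sub>M j\<in>{..<m}. borel) (\<lambda>p. \<lambda>j\<in>{..<m}. measure p (B j))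
          = dirichlet_law m
              (\<lambda>j. measure (point_measure UNIV (\<lambda>k. ennreal (c k))) (B j)))"

text \<open>For a nonzero finite base measure such a law exists (Ferguson), and it is unique because
  the evaluations on finite partitions generate the sigma-algebra.\<close>

definition dirichlet_process :: "(nat \<Rightarrow> real) \<Rightarrow> nat measure measure" where
  "dirichlet_process c = (THE Q. is_dirichlet_process c Q)"

section \<open>Posterior and plug-in estimator\<close>

text \<open>A data path consists of the departure times \<open>t i\<close> and the numbers \<open>x i\<close> of customers
  left behind, for \<open>i \<ge> 1\<close>.\<close>

definition interdeparture :: "(nat \<Rightarrow> real) \<Rightarrow> nat \<Rightarrow> real" where
  "interdeparture t i = t (i + 1) - t i"

definition posterior_rate :: "real \<Rightarrow> (nat \<Rightarrow> real) \<Rightarrow> nat \<Rightarrow> real" where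
  "posterior_rate b t n = b + (\<Sum>i=1..n. interdeparture t i)"

definition lambda_bar :: "real \<Rightarrow> real \<Rightarrow> (nat \<Rightarrow> real) \<Rightarrow> nat \<Rightarrow> real" where
  "lambda_bar a b t n = (a + real n) / posterior_rate b t n"

definition posterior_base :: "real \<Rightarrow> nat pmf \<Rightarrow> (nat \<Rightarrow> nat) \<Rightarrow> nat \<Rightarrow> nat \<Rightarrow> real" where
  "posterior_base \<alpha> c0 x n k =
     \<alpha> * pmf c0 k +
     (\<Sum>i=1..n-1. if int (x (i + 1)) - int (x i) + (1 - (if x i = 0 then 1 else 0)) = int k
                  then 1 else 0)"

text \<open>Posterior law of the pair (arrival rate, law of the number of arrivals during a service)
  given the first \<open>n\<close> data. This is the version of the conditional distribution provided by
  conjugacy; it is defined for every data path, so that statements about almost all data under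
  the true law make sense.\<close>

definition posterior ::
    "real \<Rightarrow> real \<Rightarrow> real \<Rightarrow> nat pmf \<Rightarrow> (nat \<Rightarrow> nat) \<Rightarrow> (nat \<Rightarrow> real) \<Rightarrow> nat
      \<Rightarrow> (real \<times> nat measure) measure" where
  "posterior a b \<alpha> c0 x t n =
     gamma_law (a + real n) (posterior_rate b t n)
       \<Otimes>\<^sub>M dirichlet_process (posterior_base \<alpha> c0 x n)"

definition gamma_n :: "real \<Rightarrow> nat pmf \<Rightarrow> (nat \<Rightarrow> nat) \<Rightarrow> nat \<Rightarrow> real \<Rightarrow> real" where
  "gamma_n \<alpha> c0 x n w =
     (\<Sum>k. w ^ k * (posterior_base \<alpha> c0 x n k / (\<alpha> + real n - 1)))"

definition g_hat ::
    "real \<Rightarrow> real \<Rightarrow> real \<Rightarrow> nat pmf \<Rightarrow> (nat \<Rightarrow> nat) \<Rightarrow> (nat \<Rightarrow> real) \<Rightarrow> nat \<Rightarrow> real \<Rightarrow> real" where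
  "g_hat a b \<alpha> c0 x t n z = gamma_n \<alpha> c0 x n (1 - z / lambda_bar a b t n)"

text \<open>Posterior probability that the deviation of the plug-in estimator from \<open>g\<close> on \<open>Z\<close> is at
  least \<open>\<epsilon>\<close>. The event constrains the data only and not \<open>\<theta>\<close>, as the plug-in estimator is a
  function of the data. The supremum is taken in the extended reals, so it is meaningful for
  unbounded deviations too.\<close>

definition posterior_deviation_prob ::
    "real \<Rightarrow> real \<Rightarrow> real \<Rightarrow> nat pmf \<Rightarrow> (nat \<Rightarrow> nat) \<Rightarrow> (nat \<Rightarrow> real) \<Rightarrow> nat
      \<Rightarrow> (real \<Rightarrow> real) \<Rightarrow> real set \<Rightarrow> real \<Rightarrow> real" where
  "posterior_deviation_prob a b \<alpha> c0 x t n g Z \<epsilon> =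
     \<P>(\<theta> in posterior a b \<alpha> c0 x t n.
        (SUP z\<in>Z. ereal \<bar>g_hat a b \<alpha> c0 x t n z - g z\<bar>) \<ge> ereal \<epsilon>)"

text \<open>Both generating functions, that of the prior guess \<open>c0\<close> and that of the true law \<open>p\<close>,
  converge absolutely on \<open>[-s, s]\<close>. This always holds for \<open>s = 1\<close>. For \<open>s \<ge> 1\<close>
  it makes \<open>gamma_n\<close> on \<open>[-s, s]\<close> an honest power series, for every \<open>n\<close>.\<close>

definition pgfs_converge :: "nat pmf \<Rightarrow> (nat \<Rightarrow> real) \<Rightarrow> real \<Rightarrow> bool" where
  "pgfs_converge c0 p s \<longleftrightarrow>
     summable (\<lambda>k. s ^ k * pmf c0 k) \<and> summable (\<lambda>k. s ^ k * p k)"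

end

theory Submission
  imports Defs
begin

text \<open>
The event whose posterior probability is studied compares the plug-in estimator, a function of the
data, with the true transform. Its posterior probability is therefore zero as soon as the
supremum of the deviation is smaller than \<open>\<epsilon>\<close>, and the claim reduces to almost sure uniform
convergence of the estimator.

The estimator is the generating function \<open>\<gamma>\<close> of the empirical law of the arrival counts, mixed
with the prior guess at a weight that tends to zero. It is taken at \<open>w = 1 - z / l\<close> with the
estimated rate \<open>l\<close>. The true transform \<open>g\<close> satisfies
\<open>g (\<lambda> * (1 - w)) = \<Sum>k. w ^ k * p k\<close> for the true rate \<open>\<lambda>\<close> and the arrival law \<open>p\<close>
(\<open>arrivals_law_pgf\<close>). The error thus splits into the error of \<open>\<gamma>\<close> as an estimator of this
generating function, uniformly for \<open>\<bar>w\<bar> \<le> s\<close>, and the difference between \<open>g (\<lambda> * z / l)\<close> and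
\<open>g z\<close>. The second part vanishes because \<open>l\<close> converges to \<open>\<lambda>\<close> (\<open>lambda_bar_consistent\<close>) and \<open>g\<close> is
Lipschitz on the nonnegative half-line (\<open>laplace_stieltjes_lipschitz\<close>).

For the first part, the counts read off from the Markov chain are i.i.d. with law \<open>p\<close>
(\<open>queue_arrivals_iid\<close>): the initial state and the counts determine the path, and every step has a
probability that depends on the count alone. By the strong law of large numbers the frequency of
each \<open>k\<close> converges to \<open>p k\<close> and the mean of \<open>s ^ k\<close> over the counts converges to its expectation.
Scheffe's lemma turns these two limits into convergence of the sum of \<open>s ^ k\<close> times the error of
the frequency of \<open>k\<close>, which bounds the error of \<open>\<gamma>\<close> uniformly (\<open>gamma_n_consistent\<close>).

At the largest admissible \<open>s\<close> the variable \<open>s ^ k\<close> may have a first moment only, so the strong law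
is needed for integrable variables without further moments. It is proved by comparing the
running maximum of the partial sums with that of the shifted sequence
(\<open>iid_negative_drift_bounded_above\<close>), together with Kolmogorov's zero-one law.
\<close>

section \<open>The strong law of large numbers\<close>

text \<open>\<open>running_max n f\<close> is the largest of the partial sums of \<open>f\<close> with \<open>0, \<dots>, n\<close> terms. The recursion
removes the first term of \<open>f\<close>, so that the same function appears for the shifted sequence. This
is what lets the stationarity of an i.i.d. sequence act on it.\<close>

primrec running_max :: "nat \<Rightarrow> (nat \<Rightarrow> real) \<Rightarrow> real" where
  "running_max 0 f = 0"
| "running_max (Suc n) f = max 0 (f 0 + running_max n (\<lambda>i. f (Suc i)))"

lemma sum_le_running_max: "k \<le> n \<Longrightarrow> (\<Sum>i<k. f i) \<le> running_max n f"
proof (induction n arbitrary: k f)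
  case (Suc n)
  show ?case
  proof (cases k)
    case (Suc j)
    then show ?thesis
      using Suc.IH[of j "\<lambda>i. f (Suc i)"] Suc.prems by (simp add: sum.lessThan_Suc_shift del: sum.lessThan_Suc)
  qed simp
qed simp

lemma running_max_le: "(\<And>k. k \<le> n \<Longrightarrow> (\<Sum>i<k. f i) \<le> B) \<Longrightarrow> running_max n f \<le> B"
proof (induction n arbitrary: f B)
  case 0
  show ?case using "0.prems"[of 0] by simp
next
  case (Suc n)
  have "(\<Sum>i<k. f (Suc i)) \<le> B - f 0" if "k \<le> n" for k
    using Suc.prems[of "Suc k"] that by (simp add: sum.lessThan_Suc_shift del: sum.lessThan_Suc)
  then have "running_max n (\<lambda>i. f (Suc i)) \<le> B - f 0" by (rule Suc.IH)
  then show ?case using Suc.prems[of 0] by simp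
qed

lemma running_max_nonneg: "0 \<le> running_max n f"
  using sum_le_running_max[of 0 n f] by simp

lemma running_max_mono: "m \<le> n \<Longrightarrow> running_max m f \<le> running_max n f"
  by (intro running_max_le sum_le_running_max) auto

lemma borel_measurable_running_max [measurable]:
  assumes "\<And>i. X i \<in> borel_measurable M"
  shows "(\<lambda>\<omega>. running_max n (\<lambda>i. X i \<omega>)) \<in> borel_measurable M"
  using assms by (induction n arbitrary: X) simp_all

lemma integrable_running_max:
  assumes "\<And>i. integrable M (X i)"
  shows "integrable M (\<lambda>\<omega>. running_max n (\<lambda>i. X i \<omega>))"
  using assms by (induction n arbitrary: X) simp_all

text \<open>With \<open>s\<close> the partial sums and \<open>c\<close> the sum of the first \<open>m\<close> terms, the right-hand side speaks of
the later terms only. This makes boundedness of the partial sums a tail event.\<close>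

lemma bounded_above_drop_iff:
  fixes s :: "nat \<Rightarrow> real"
  shows "(\<exists>B. \<forall>n. s n \<le> B) \<longleftrightarrow> (\<exists>B. \<forall>n. s (m + n) - c \<le> B)"
proof
  assume "\<exists>B. \<forall>n. s n \<le> B"
  then obtain B where "\<And>n. s n \<le> B" by blast
  then show "\<exists>B. \<forall>n. s (m + n) - c \<le> B" by (intro exI[of _ "B - c"]) simp
next
  assume "\<exists>B. \<forall>n. s (m + n) - c \<le> B"
  then obtain B where B: "\<And>n. s (m + n) - c \<le> B" by blast
  have "s n \<le> max (Max (s ` {..m})) (B + c)" for n
  proof (cases "n \<le> m")
    case False
    then show ?thesis using B[of "n - m"] by simp
  qed (simp add: le_max_iff_disj)
  then show "\<exists>B. \<forall>n. s n \<le> B" by blast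
qed

text \<open>With countably many bounds the event of boundedness is visibly measurable.\<close>

lemma ex_real_bound_iff_nat: "(\<exists>B::real. \<forall>n. s n \<le> B) \<longleftrightarrow> (\<exists>B::nat. \<forall>n. s n \<le> real B)"
  by (meson order_trans real_arch_simple)

context prob_space
begin

lemma bounded_partial_sums_zero_one:
  fixes X :: "nat \<Rightarrow> 'a \<Rightarrow> real"
  assumes indep: "indep_vars (\<lambda>_. borel) X UNIV"
  defines "E \<equiv> {\<omega> \<in> space M. \<exists>B. \<forall>n. (\<Sum>i<n. X i \<omega>) \<le> B}"
  shows "prob E = 0 \<or> prob E = 1"
proof (rule kolmogorov_0_1_law)
  let ?A = "\<lambda>i. sigma_sets (space M) {X i -` B \<inter> space M | B. B \<in> sets borel}"
  show "indep_sets ?A UNIV" using indep by (simp add: indep_vars_def)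
  show "sigma_algebra (space M) (?A i)" for i
    by (rule sigma_algebra_sigma_sets) auto
  show "E \<in> tail_events ?A"
    unfolding tail_events_def
  proof (intro INT_I)
    fix m :: nat
    let ?N = "sigma (space M) (\<Union> (?A ` {m..}))"
    have sub: "\<Union> (?A ` {m..}) \<subseteq> Pow (space M)"
      by (auto dest: sigma_sets_into_sp[rotated])
    have sN: "sets ?N = sigma_sets (space M) (\<Union> (?A ` {m..}))" by (rule sets_measure_of[OF sub])
    have [measurable]: "X i \<in> borel_measurable ?N" if "m \<le> i" for i
    proof (rule measurableI)
      fix B :: "real set" assume "B \<in> sets borel"
      then have "X i -` B \<inter> space M \<in> \<Union> (?A ` {m..})"
        using that by (intro UN_I[of i] sigma_sets.Basic) auto
      then show "X i -` B \<inter> space ?N \<in> sets ?N"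
        unfolding sN space_measure_of_conv by (rule sigma_sets.Basic)
    qed simp
    have "E = {\<omega> \<in> space ?N. \<exists>B::nat. \<forall>n. (\<Sum>i=m..<m+n. X i \<omega>) \<le> real B}"
    proof -
      have "(\<Sum>i=m..<m+n. X i \<omega>) = (\<Sum>i<m+n. X i \<omega>) - (\<Sum>i<m. X i \<omega>)" for \<omega> n
        using sum.atLeastLessThan_concat[of 0 m "m + n" "\<lambda>i. X i \<omega>"] by (simp add: lessThan_atLeast0)
      then have "(\<exists>B. \<forall>n. (\<Sum>i<n. X i \<omega>) \<le> B) \<longleftrightarrow> (\<exists>B. \<forall>n. (\<Sum>i=m..<m+n. X i \<omega>) \<le> B)" for \<omega>
        using bounded_above_drop_iff[of "\<lambda>n. \<Sum>i<n. X i \<omega>" m "\<Sum>i<m. X i \<omega>"] by presburger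
      then show ?thesis
        unfolding E_def ex_real_bound_iff_nat[symmetric] space_measure_of_conv by simp
    qed
    also have "\<dots> \<in> sets ?N" by measurable
    finally show "E \<in> sigma_sets (space M) (\<Union> (?A ` {m..}))" by (simp only: sN)
  qed
qed

text \<open>The data are indexed from \<open>1\<close>, and the strong law compares a sequence with its shift. Both call
for moving independence along an injection of the index sets.\<close>

lemma indep_vars_reindex:
  assumes inj: "inj_on f I" and indep: "indep_vars N X (f ` I)"
  shows "indep_vars (N \<circ> f) (X \<circ> f) I"
  unfolding indep_vars_def2 indep_sets_def
proof (intro conjI ballI allI impI)
  fix J A assume J: "J \<subseteq> I" "J \<noteq> {}" "finite J"
    and A: "A \<in> (\<Pi> i\<in>J. {(X \<circ> f) i -` B \<inter> space M | B. B \<in> sets ((N \<circ> f) i)})"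
  have injJ: "inj_on f J" using inj J(1) by (rule inj_on_subset)
  define A' where "A' = A \<circ> the_inv_into J f"
  have A': "A' (f i) = A i" if "i \<in> J" for i
    using the_inv_into_f_f[OF injJ that] by (simp add: A'_def)
  have "A' \<in> (\<Pi> j\<in>f ` J. {X j -` B \<inter> space M | B. B \<in> sets (N j)})"
    using A A' by (auto simp: Pi_iff)
  moreover have "f ` J \<subseteq> f ` I" "f ` J \<noteq> {}" "finite (f ` J)" using J by auto
  ultimately have "prob (\<Inter>j\<in>f ` J. A' j) = (\<Prod>j\<in>f ` J. prob (A' j))"
    using indep unfolding indep_vars_def2 indep_sets_def by blast
  then show "prob (\<Inter>j\<in>J. A j) = (\<Prod>j\<in>J. prob (A j))"
    using A' by (simp add: prod.reindex[OF injJ])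
qed (use indep in \<open>auto simp: indep_vars_def2\<close>)

text \<open>By independence, both laws are the product of the common marginal law.\<close>

lemma iid_shift_distr:
  fixes X :: "nat \<Rightarrow> 'a \<Rightarrow> real"
  assumes indep: "indep_vars (\<lambda>_. borel) X UNIV"
    and ident: "\<And>i. distr M borel (X i) = distr M borel (X 0)"
  shows "distr M (\<Pi>\<^sub>M i\<in>UNIV. borel) (\<lambda>\<omega> i. X (Suc i) \<omega>) = distr M (\<Pi>\<^sub>M i\<in>UNIV. borel) (\<lambda>\<omega> i. X i \<omega>)"
proof -
  have rv: "random_variable borel (X i)" for i using indep by (simp add: indep_vars_def2)
  have indep': "indep_vars (\<lambda>_. borel) (\<lambda>i. X (Suc i)) UNIV"
  proof -
    have "indep_vars (\<lambda>_. borel) X (range Suc)" using indep by (rule indep_vars_subset) simp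
    then have "indep_vars ((\<lambda>_. borel) \<circ> Suc) (X \<circ> Suc) UNIV"
      by (rule indep_vars_reindex[rotated]) simp
    then show ?thesis by (simp add: comp_def)
  qed
  have law: "distr M (\<Pi>\<^sub>M i\<in>UNIV. borel) (\<lambda>\<omega> i. Y i \<omega>) = (\<Pi>\<^sub>M i\<in>UNIV. distr M borel (Y i))"
    if Y: "indep_vars (\<lambda>_. borel) Y UNIV" for Y :: "nat \<Rightarrow> 'a \<Rightarrow> real"
  proof -
    have "random_variable borel (Y i)" for i using Y by (simp add: indep_vars_def2)
    from indep_vars_iff_distr_eq_PiM[where I=UNIV and M'="\<lambda>_. borel" and X=Y, OF UNIV_not_empty this] Y
    show ?thesis by (simp add: restrict_UNIV)
  qed
  have "(\<Pi>\<^sub>M i\<in>UNIV. distr M borel (X (Suc i))) = (\<Pi>\<^sub>M i\<in>UNIV. distr M borel (X i))"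
    by (intro PiM_cong refl) (rule trans[OF ident ident[symmetric]])
  then show ?thesis using law[OF indep] law[OF indep'] by simp
qed

text \<open>The heart of the strong law. Let \<open>R n\<close> and \<open>R' n\<close> be the running maxima of \<open>X\<close> and of its
shift. They have the same expectation, and \<open>R (Suc n) - R' n = max (- R' n) (X 0)\<close>. As \<open>R\<close>
increases with \<open>n\<close>, the expectation of \<open>max (- R' n) (X 0)\<close> is nonnegative. If the partial sums
were almost surely unbounded, then \<open>R' n\<close> would grow to infinity, these variables would tend to
\<open>X 0\<close> under the dominating function \<open>\<bar>X 0\<bar>\<close>, and \<open>X 0\<close> would have a nonnegative expectation.
Hence boundedness has positive probability, and the zero-one law raises it to one.\<close>

lemma iid_negative_drift_bounded_above:
  fixes X :: "nat \<Rightarrow> 'a \<Rightarrow> real"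
  assumes indep: "indep_vars (\<lambda>_. borel) X UNIV"
    and ident: "\<And>i. distr M borel (X i) = distr M borel (X 0)"
    and int: "integrable M (X 0)"
    and neg: "expectation (X 0) < 0"
  shows "AE \<omega> in M. \<exists>B. \<forall>n. (\<Sum>i<n. X i \<omega>) \<le> B"
proof -
  let ?E = "{\<omega> \<in> space M. \<exists>B. \<forall>n. (\<Sum>i<n. X i \<omega>) \<le> B}"
  have rv [measurable]: "random_variable borel (X i)" for i using indep by (simp add: indep_vars_def2)
  have E [measurable]: "?E \<in> events" unfolding ex_real_bound_iff_nat by measurable
  have ints: "integrable M (X i)" for i
  proof -
    have "integrable (distr M borel (X i)) (\<lambda>x. x)"
      unfolding ident[of i] using int by (simp add: integrable_distr_eq)
    then show ?thesis by (simp add: integrable_distr_eq)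
  qed
  have "prob ?E \<noteq> 0"
  proof
    assume "prob ?E = 0"
    then have "AE \<omega> in M. \<omega> \<notin> ?E" by (subst (asm) prob_eq_0) auto
    then have unb: "AE \<omega> in M. \<forall>B. \<exists>n. (\<Sum>i<n. X i \<omega>) > B"
      using AE_space by eventually_elim (auto simp: not_le)
    define R where "R n \<omega> = running_max n (\<lambda>i. X i \<omega>)" for n \<omega>
    define R' where "R' n \<omega> = running_max n (\<lambda>i. X (Suc i) \<omega>)" for n \<omega>
    have [measurable]: "R' n \<in> borel_measurable M" for n unfolding R'_def by measurable
    have iR: "integrable M (R n)" "integrable M (R' n)" for n
      unfolding R_def R'_def by (intro integrable_running_max ints)+
    \<comment> \<open>The running maximum is a function of the whole sequence, whose law is invariant under the shift.\<close>
    have same: "expectation (R' n) = expectation (R n)" for n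
    proof -
      have [measurable]: "running_max n \<in> borel_measurable (\<Pi>\<^sub>M i\<in>UNIV. borel)"
        using borel_measurable_running_max[of "\<lambda>i f. f i" "\<Pi>\<^sub>M i\<in>UNIV. borel" n] by simp
      have m: "(\<lambda>\<omega> i. X i \<omega>) \<in> measurable M (\<Pi>\<^sub>M i\<in>UNIV. borel)"
        "(\<lambda>\<omega> i. X (Suc i) \<omega>) \<in> measurable M (\<Pi>\<^sub>M i\<in>UNIV. borel)"
        by (auto intro!: measurable_PiM_single' )
      show ?thesis
        using integral_distr[OF m(1), of "running_max n"] integral_distr[OF m(2), of "running_max n"]
          iid_shift_distr[OF indep ident]
        by (simp add: R_def[abs_def] R'_def[abs_def])
    qed
    have step: "max (- R' n \<omega>) (X 0 \<omega>) = R (Suc n) \<omega> - R' n \<omega>" for n \<omega>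
      by (simp add: R_def R'_def)
    have "(\<lambda>n. expectation (\<lambda>\<omega>. max (- R' n \<omega>) (X 0 \<omega>))) \<longlonglongrightarrow> expectation (X 0)"
    proof (rule integral_dominated_convergence[where w="\<lambda>\<omega>. \<bar>X 0 \<omega>\<bar>"])
      show "AE \<omega> in M. (\<lambda>n. max (- R' n \<omega>) (X 0 \<omega>)) \<longlonglongrightarrow> X 0 \<omega>"
        using unb
      proof eventually_elim
        case (elim \<omega>)
        have "\<exists>n. (\<Sum>i<n. X (Suc i) \<omega>) > - X 0 \<omega>"
        proof -
          obtain k where k: "(\<Sum>i<k. X i \<omega>) > max 0 0" using elim by blast
          then obtain n where "k = Suc n" by (cases k) auto
          then show ?thesis using k
            by (intro exI[of _ n]) (simp add: sum.lessThan_Suc_shift del: sum.lessThan_Suc)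
        qed
        then obtain m where m: "R' m \<omega> > - X 0 \<omega>"
          unfolding R'_def using sum_le_running_max[OF order_refl, of "\<lambda>i. X (Suc i) \<omega>"]
          by (meson less_le_trans)
        have "eventually (\<lambda>n. max (- R' n \<omega>) (X 0 \<omega>) = X 0 \<omega>) sequentially"
          using eventually_ge_at_top[of m]
        proof eventually_elim
          case (elim n)
          then show ?case using m running_max_mono[of m n "\<lambda>i. X (Suc i) \<omega>"] by (simp add: R'_def)
        qed
        then show ?case by (rule tendsto_eventually)
      qed
      show "AE \<omega> in M. norm (max (- R' n \<omega>) (X 0 \<omega>)) \<le> \<bar>X 0 \<omega>\<bar>" for n
      proof (rule AE_I2)
        fix \<omega>
        show "norm (max (- R' n \<omega>) (X 0 \<omega>)) \<le> \<bar>X 0 \<omega>\<bar>"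
          using running_max_nonneg[of n "\<lambda>i. X (Suc i) \<omega>"] by (auto simp: R'_def max_def abs_if)
      qed
    qed (use int in auto)
    moreover have "expectation (\<lambda>\<omega>. max (- R' n \<omega>) (X 0 \<omega>)) \<ge> 0" for n
    proof -
      have "expectation (\<lambda>\<omega>. max (- R' n \<omega>) (X 0 \<omega>)) = expectation (R (Suc n)) - expectation (R n)"
        unfolding step using Bochner_Integration.integral_diff[OF iR(1)[of "Suc n"] iR(2)[of n]] same[of n] by simp
      moreover have "expectation (R n) \<le> expectation (R (Suc n))"
        by (rule integral_mono[OF iR(1) iR(1)]) (simp add: R_def running_max_mono del: running_max.simps)
      ultimately show ?thesis by simp
    qed
    ultimately have "expectation (X 0) \<ge> 0"
      by (intro LIMSEQ_le_const) auto
    then show False using neg by simp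
  qed
  then have "prob ?E = 1" using bounded_partial_sums_zero_one[OF indep] by blast
  then have "AE \<omega> in M. \<omega> \<in> ?E" using E by (simp add: prob_eq_1)
  then show ?thesis by eventually_elim simp
qed

text \<open>Subtracting slightly more than the mean gives a negative drift, and sums that are bounded above
have averages with a nonpositive upper limit.\<close>

lemma iid_mean_eventually_le:
  fixes X :: "nat \<Rightarrow> 'a \<Rightarrow> real"
  assumes indep: "indep_vars (\<lambda>_. borel) X UNIV"
    and ident: "\<And>i. distr M borel (X i) = distr M borel (X 0)"
    and int: "integrable M (X 0)"
  shows "AE \<omega> in M. \<forall>e>0. eventually (\<lambda>n. (\<Sum>i<n. X i \<omega>) / n < expectation (X 0) + e) sequentially"
proof -
  let ?\<mu> = "expectation (X 0)"
  have rv [measurable]: "random_variable borel (X i)" for i using indep by (simp add: indep_vars_def2)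
  have "AE \<omega> in M. \<forall>k::nat. \<exists>B. \<forall>n. (\<Sum>i<n. X i \<omega> - (?\<mu> + 1 / Suc k)) \<le> B"
  proof (subst AE_all_countable, rule allI)
    fix k :: nat
    let ?c = "?\<mu> + 1 / real (Suc k)"
    show "AE \<omega> in M. \<exists>B. \<forall>n. (\<Sum>i<n. X i \<omega> - ?c) \<le> B"
    proof (rule iid_negative_drift_bounded_above)
      show "indep_vars (\<lambda>_. borel) (\<lambda>i \<omega>. X i \<omega> - ?c) UNIV"
        using indep by (rule indep_vars_compose2) simp
      show "distr M borel (\<lambda>\<omega>. X i \<omega> - ?c) = distr M borel (\<lambda>\<omega>. X 0 \<omega> - ?c)" for i
        using distr_distr[of "\<lambda>x. x - ?c" borel borel "X i" M] distr_distr[of "\<lambda>x. x - ?c" borel borel "X 0" M] ident[of i]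
        by (simp add: comp_def)
      show "expectation (\<lambda>\<omega>. X 0 \<omega> - ?c) < 0" using int by (simp add: prob_space add_pos_pos)
    qed (use int in simp)
  qed
  then show ?thesis
  proof eventually_elim
    case (elim \<omega>)
    show ?case
    proof (intro allI impI)
      fix e :: real assume "e > 0"
      then obtain k where k: "1 / real (Suc k) < e / 2"
        using reals_Archimedean[of "e / 2"] by (auto simp: inverse_eq_divide)
      obtain B where B: "\<And>n. (\<Sum>i<n. X i \<omega> - (?\<mu> + 1 / Suc k)) \<le> B" using elim by blast
      have "(\<lambda>n. B / real n) \<longlonglongrightarrow> 0" by (rule lim_const_over_n)
      then have "eventually (\<lambda>n. B / real n < e / 2) sequentially"
        using \<open>e > 0\<close> by (intro order_tendstoD(2)) auto
      then show "eventually (\<lambda>n. (\<Sum>i<n. X i \<omega>) / n < ?\<mu> + e) sequentially"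
        using eventually_gt_at_top[of 0]
      proof eventually_elim
        case (elim n)
        have "(\<Sum>i<n. X i \<omega>) \<le> B + n * (?\<mu> + 1 / Suc k)"
          using B[of n] by (simp add: sum_subtractf)
        then have "(\<Sum>i<n. X i \<omega>) / n \<le> B / n + (?\<mu> + 1 / Suc k)"
          using elim by (simp add: field_simps del: of_nat_Suc)
        then show ?case using elim k by linarith
      qed
    qed
  qed
qed

text \<open>The upper bound for the averages applies to \<open>X\<close> and to \<open>- X\<close>. Integrability is all that the
application can supply: at an end point \<open>s\<close> of the interval of convergence of a generating
function, \<open>s ^ Y\<close> can be integrable with infinite variance.\<close>

theorem strong_law_of_large_numbers:
  fixes X :: "nat \<Rightarrow> 'a \<Rightarrow> real"
  assumes indep: "indep_vars (\<lambda>_. borel) X UNIV"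
    and ident: "\<And>i. distr M borel (X i) = distr M borel (X 0)"
    and int: "integrable M (X 0)"
  shows "AE \<omega> in M. (\<lambda>n. (\<Sum>i<n. X i \<omega>) / n) \<longlonglongrightarrow> expectation (X 0)"
proof -
  have rv [measurable]: "random_variable borel (X i)" for i using indep by (simp add: indep_vars_def2)
  have "AE \<omega> in M. \<forall>e>0. eventually (\<lambda>n. (\<Sum>i<n. - X i \<omega>) / n < expectation (\<lambda>\<omega>. - X 0 \<omega>) + e) sequentially"
  proof (rule iid_mean_eventually_le)
    show "indep_vars (\<lambda>_. borel) (\<lambda>i \<omega>. - X i \<omega>) UNIV"
      using indep by (rule indep_vars_compose2) simp
    show "distr M borel (\<lambda>\<omega>. - X i \<omega>) = distr M borel (\<lambda>\<omega>. - X 0 \<omega>)" for i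
      using distr_distr[of uminus borel borel "X i" M] distr_distr[of uminus borel borel "X 0" M] ident[of i]
      by (simp add: comp_def)
  qed (use int in simp)
  with iid_mean_eventually_le[OF assms] show ?thesis
  proof eventually_elim
    case (elim \<omega>)
    show ?case
    proof (rule order_tendstoI)
      fix c assume "c < expectation (X 0)"
      then show "eventually (\<lambda>n. c < (\<Sum>i<n. X i \<omega>) / n) sequentially"
        using elim(2)[rule_format, of "expectation (X 0) - c"]
        by (auto elim!: eventually_mono simp: sum_negf)
    next
      fix c assume "expectation (X 0) < c"
      then show "eventually (\<lambda>n. (\<Sum>i<n. X i \<omega>) / n < c) sequentially"
        using elim(1)[rule_format, of "c - expectation (X 0)"] by simp
    qed
  qed
qed

lemma strong_law_of_large_numbers_from_1:
  fixes X :: "nat \<Rightarrow> 'a \<Rightarrow> real"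
  assumes indep: "indep_vars (\<lambda>_. borel) X {1..}"
    and ident: "\<And>i. i \<ge> 1 \<Longrightarrow> distr M borel (X i) = distr M borel (X 1)"
    and int: "integrable M (X 1)"
  shows "AE \<omega> in M. (\<lambda>n. (\<Sum>i=1..n. X i \<omega>) / n) \<longlonglongrightarrow> expectation (X 1)"
proof -
  have "indep_vars (\<lambda>_. borel) X (range Suc)" using indep by (rule indep_vars_subset) auto
  then have "indep_vars ((\<lambda>_. borel) \<circ> Suc) (X \<circ> Suc) UNIV" by (rule indep_vars_reindex[rotated]) simp
  then have "indep_vars (\<lambda>_. borel) (\<lambda>i. X (Suc i)) UNIV" by (simp add: comp_def)
  then have "AE \<omega> in M. (\<lambda>n. (\<Sum>i<n. X (Suc i) \<omega>) / n) \<longlonglongrightarrow> expectation (X (Suc 0))"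
  proof (rule strong_law_of_large_numbers)
    show "distr M borel (X (Suc i)) = distr M borel (X (Suc 0))" for i
      using ident[of "Suc i"] by simp
  qed (use int in simp)
  then show ?thesis by (simp add: sum.atLeast1_atMost_eq)
qed

text \<open>The function \<open>f (Y \<omega>)\<close> is the sum over \<open>k\<close> of its restrictions to the events \<open>Y = k\<close>, and the
sum may be integrated term by term.\<close>

lemma has_expectation_nat_valued:
  fixes Y :: "'a \<Rightarrow> nat" and f :: "nat \<Rightarrow> real"
  assumes Y [measurable]: "random_variable (count_space UNIV) Y"
    and mass: "\<And>k. prob {\<omega> \<in> space M. Y \<omega> = k} = p k"
    and sum: "summable (\<lambda>k. \<bar>f k\<bar> * p k)"
  shows "integrable M (\<lambda>\<omega>. f (Y \<omega>))" "expectation (\<lambda>\<omega>. f (Y \<omega>)) = (\<Sum>k. f k * p k)"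
proof -
  define g where "g k \<omega> = (if k = Y \<omega> then f k else 0)" for k \<omega>
  have g: "g k \<omega> = f k * indicator {\<omega> \<in> space M. Y \<omega> = k} \<omega>" if "\<omega> \<in> space M" for k \<omega>
    using that by (auto simp: g_def)
  have gm [measurable]: "g k \<in> borel_measurable M" for k unfolding g_def by measurable
  have int: "integrable M (g k)" for k
    by (rule integrable_const_bound[where B="\<bar>f k\<bar>"]) (auto simp: g_def)
  have eg: "expectation (g k) = f k * p k" for k
  proof -
    have "expectation (g k) = expectation (\<lambda>\<omega>. f k * indicator {\<omega> \<in> space M. Y \<omega> = k} \<omega>)"
      by (rule Bochner_Integration.integral_cong) (use g in auto)
    then show ?thesis by (simp add: mass)
  qed
  have en: "expectation (\<lambda>\<omega>. norm (g k \<omega>)) = \<bar>f k\<bar> * p k" for k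
  proof -
    have "expectation (\<lambda>\<omega>. norm (g k \<omega>)) = expectation (\<lambda>\<omega>. \<bar>f k\<bar> * indicator {\<omega> \<in> space M. Y \<omega> = k} \<omega>)"
      by (rule Bochner_Integration.integral_cong) (use g in \<open>auto simp: abs_mult\<close>)
    then show ?thesis by (simp add: mass)
  qed
  have gs: "(\<lambda>k. g k \<omega>) sums f (Y \<omega>)" for \<omega> unfolding g_def by (rule sums_single)
  have gn: "summable (\<lambda>k. norm (g k \<omega>))" for \<omega>
    unfolding g_def if_distrib[of norm] norm_zero by (rule summable_single)
  have "summable (\<lambda>k. expectation (\<lambda>\<omega>. norm (g k \<omega>)))" using sum en by simp
  note integrable_suminf[OF int AE_I2[OF gn] this] integral_suminf[OF int AE_I2[OF gn] this]
  then show "integrable M (\<lambda>\<omega>. f (Y \<omega>))" "expectation (\<lambda>\<omega>. f (Y \<omega>)) = (\<Sum>k. f k * p k)"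
    by (simp_all add: sums_unique[OF gs, symmetric] eg)
qed

lemma strong_law_nat_valued:
  fixes Y :: "nat \<Rightarrow> 'a \<Rightarrow> nat" and f :: "nat \<Rightarrow> real"
  assumes indep: "indep_vars (\<lambda>_. count_space UNIV) Y {1..}"
    and mass: "\<And>i k. i \<ge> 1 \<Longrightarrow> prob {\<omega> \<in> space M. Y i \<omega> = k} = p k"
    and sum: "summable (\<lambda>k. \<bar>f k\<bar> * p k)"
  shows "AE \<omega> in M. (\<lambda>n. (\<Sum>i=1..n. f (Y i \<omega>)) / n) \<longlonglongrightarrow> (\<Sum>k. f k * p k)"
proof -
  have rv [measurable]: "i \<ge> 1 \<Longrightarrow> random_variable (count_space UNIV) (Y i)" for i
    using indep by (simp add: indep_vars_def2)
  have same: "distr M (count_space UNIV) (Y i) = distr M (count_space UNIV) (Y 1)" if "i \<ge> 1" for i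
  proof (rule measure_eqI_countable)
    have "emeasure (distr M (count_space UNIV) (Y j)) {k} = ennreal (p k)" if "j \<ge> 1" for j k
      using mass[OF that, of k] rv[OF that] by (simp add: emeasure_distr emeasure_eq_measure vimage_def Int_def conj_commute)
    then show "emeasure (distr M (count_space UNIV) (Y i)) {k} = emeasure (distr M (count_space UNIV) (Y 1)) {k}" for k
      using that by simp
  qed auto
  have "AE \<omega> in M. (\<lambda>n. (\<Sum>i=1..n. f (Y i \<omega>)) / n) \<longlonglongrightarrow> expectation (\<lambda>\<omega>. f (Y 1 \<omega>))"
  proof (rule strong_law_of_large_numbers_from_1)
    show "indep_vars (\<lambda>_. borel) (\<lambda>i \<omega>. f (Y i \<omega>)) {1..}"
      using indep by (rule indep_vars_compose2) simp
    show "distr M borel (\<lambda>\<omega>. f (Y i \<omega>)) = distr M borel (\<lambda>\<omega>. f (Y 1 \<omega>))" if "i \<ge> 1" for i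
    proof -
      have "distr M borel (\<lambda>\<omega>. f (Y j \<omega>)) = distr (distr M (count_space UNIV) (Y j)) borel f" if "j \<ge> 1" for j
        using rv[OF that] by (simp add: distr_distr comp_def)
      then show ?thesis using same[OF that] that by simp
    qed
    show "integrable M (\<lambda>\<omega>. f (Y 1 \<omega>))"
      by (rule has_expectation_nat_valued(1)[OF rv mass sum]) simp_all
  qed
  moreover have "expectation (\<lambda>\<omega>. f (Y 1 \<omega>)) = (\<Sum>k. f k * p k)"
    by (rule has_expectation_nat_valued(2)[OF rv mass sum]) simp_all
  ultimately show ?thesis by simp
qed

end

section \<open>The arrival counts of the queue are i.i.d.\<close>

text \<open>The singletons, with the empty and the full set added, generate the discrete sigma-algebra and
are stable under intersection. A factor that is the full set can be dropped, which is why the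
hypothesis asks for all finite sets of indices.\<close>

lemma (in prob_space) indep_vars_countI:
  fixes Y :: "'i \<Rightarrow> 'a \<Rightarrow> nat"
  assumes rv: "\<And>i. i \<in> I \<Longrightarrow> random_variable (count_space UNIV) (Y i)"
    and mass: "\<And>J k. finite J \<Longrightarrow> J \<subseteq> I \<Longrightarrow>
      prob {\<omega> \<in> space M. \<forall>j\<in>J. Y j \<omega> = k j} = (\<Prod>j\<in>J. prob {\<omega> \<in> space M. Y j \<omega> = k j})"
  shows "indep_vars (\<lambda>_. count_space UNIV) Y I"
proof -
  let ?E = "insert UNIV (insert {} (range (\<lambda>k::nat. {k})))"
  have gen: "sets (count_space UNIV) = sigma_sets (space (count_space UNIV)) ?E"
  proof (intro equalityI subsetI)
    fix S :: "nat set"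
    have "(if k \<in> S then {k} else {}) \<in> sigma_sets UNIV ?E" for k
      by (auto intro: sigma_sets.Basic)
    then have "(\<Union>k. if k \<in> S then {k} else {}) \<in> sigma_sets UNIV ?E" by (rule sigma_sets.Union)
    also have "(\<Union>k. if k \<in> S then {k} else {}) = S" by auto
    finally show "S \<in> sigma_sets (space (count_space UNIV)) ?E" by simp
  qed simp
  have fin: "indep_vars (\<lambda>_. count_space UNIV) Y J" if J: "J \<subseteq> I" "J \<noteq> {}" "finite J" for J
  proof (subst indep_vars_finite[where E="\<lambda>_. ?E", OF J(2,3)])
    show "Int_stable ?E" by (auto simp: Int_stable_def)
    show "\<forall>A\<in>J \<rightarrow> ?E. prob (\<Inter>j\<in>J. Y j -` A j \<inter> space M) = (\<Prod>j\<in>J. prob (Y j -` A j \<inter> space M))"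
    proof
      fix A assume A: "A \<in> J \<rightarrow> ?E"
      show "prob (\<Inter>j\<in>J. Y j -` A j \<inter> space M) = (\<Prod>j\<in>J. prob (Y j -` A j \<inter> space M))"
      proof (cases "\<exists>j\<in>J. A j = {}")
        case True
        then obtain j where j: "j \<in> J" "A j = {}" by blast
        then have "(\<Inter>j\<in>J. Y j -` A j \<inter> space M) = {}" by blast
        moreover have "(\<Prod>j\<in>J. prob (Y j -` A j \<inter> space M)) = 0"
          using j J(3) by (intro prod_zero bexI[of _ j]) auto
        ultimately show ?thesis by simp
      next
        case False
        define J' where "J' = {j \<in> J. A j \<noteq> UNIV}"
        define k where "k j = the_elem (A j)" for j
        have Aj: "A j = {k j}" if "j \<in> J'" for j
        proof -
          have "A j \<in> ?E" using that A unfolding J'_def by blast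
          then show ?thesis using False that unfolding J'_def k_def by auto
        qed
        have "(\<Inter>j\<in>J. Y j -` A j \<inter> space M) = {\<omega> \<in> space M. \<forall>j\<in>J'. Y j \<omega> = k j}"
        proof (intro equalityI subsetI)
          fix \<omega> assume \<omega>: "\<omega> \<in> (\<Inter>j\<in>J. Y j -` A j \<inter> space M)"
          have "Y j \<omega> = k j" if "j \<in> J'" for j
          proof -
            have "Y j \<omega> \<in> A j" using \<omega> that unfolding J'_def by blast
            then show ?thesis by (simp only: Aj[OF that] singleton_iff)
          qed
          then show "\<omega> \<in> {\<omega> \<in> space M. \<forall>j\<in>J'. Y j \<omega> = k j}" using \<omega> J(2) by blast
        next
          fix \<omega> assume \<omega>: "\<omega> \<in> {\<omega> \<in> space M. \<forall>j\<in>J'. Y j \<omega> = k j}"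
          have "Y j \<omega> \<in> A j" if "j \<in> J" for j
          proof (cases "j \<in> J'")
            case True
            then show ?thesis using \<omega> by (simp add: Aj)
          next
            case False
            then show ?thesis using that by (simp add: J'_def)
          qed
          then show "\<omega> \<in> (\<Inter>j\<in>J. Y j -` A j \<inter> space M)" using \<omega> by blast
        qed
        moreover have "(\<Prod>j\<in>J. prob (Y j -` A j \<inter> space M)) = (\<Prod>j\<in>J'. prob (Y j -` A j \<inter> space M))"
          using J(3) by (intro prod.mono_neutral_right) (auto simp: J'_def prob_space)
        moreover have "prob (Y j -` A j \<inter> space M) = prob {\<omega> \<in> space M. Y j \<omega> = k j}" if "j \<in> J'" for j
          using Aj[OF that] by (intro arg_cong[where f=prob]) auto
        moreover have "prob {\<omega> \<in> space M. \<forall>j\<in>J'. Y j \<omega> = k j} = (\<Prod>j\<in>J'. prob {\<omega> \<in> space M. Y j \<omega> = k j})"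
          using J by (intro mass) (auto simp: J'_def)
        ultimately show ?thesis by simp
      qed
    qed
  qed (use J rv gen in auto)
  show ?thesis
    unfolding indep_vars_def2
    by (subst indep_sets_finite_index_sets) (use fin rv in \<open>auto simp: indep_vars_def2\<close>)
qed

text \<open>The number of arrivals during service \<open>i + 1\<close>, read off from the numbers of customers left
behind. A departure that empties the system is followed by an arrival that precedes the
service, and this arrival is not counted. The value is an integer because nothing forces a path
\<open>x\<close> to decrease by at most one in each step.\<close>

definition arrivals_during_service :: "(nat \<Rightarrow> nat) \<Rightarrow> nat \<Rightarrow> int" where
  "arrivals_during_service x i = int (x (i + 1)) - int (x i) + (1 - (if x i = 0 then 1 else 0))"

text \<open>The only path that starts in \<open>x\<close> at time \<open>1\<close> and has \<open>k i\<close> arrivals in step \<open>i\<close>. The value at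
time \<open>0\<close> is a placeholder. The subtraction never truncates, as it is applied only when the
system is not empty.\<close>

primrec departure_path :: "nat \<Rightarrow> (nat \<Rightarrow> nat) \<Rightarrow> nat \<Rightarrow> nat" where
  "departure_path x k 0 = x"
| "departure_path x k (Suc i) =
     (if i = 0 then x else departure_path x k i + k i - (if departure_path x k i = 0 then 0 else 1))"

lemma transition_matrix_departure_path:
  "i \<ge> 1 \<Longrightarrow> transition_matrix p (departure_path x k i) (departure_path x k (Suc i)) = p (k i)"
  by (auto simp: transition_matrix_def)

text \<open>The initial state and the arrival counts determine the path, and conversely. An event about
arrivals thus becomes an event about the path, whose probability the Markov property gives.\<close>

lemma arrivals_eq_iff_departure_path:
  "x 1 = x1 \<and> (\<forall>i\<in>{1..n}. arrivals_during_service x i = int (k i))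
    \<longleftrightarrow> (\<forall>i\<in>{1..n+1}. x i = departure_path x1 k i)"
proof (induction n)
  case (Suc n)
  have "arrivals_during_service x (Suc n) = int (k (Suc n)) \<longleftrightarrow> x (Suc (Suc n)) = departure_path x1 k (Suc (Suc n))"
    if "x (Suc n) = departure_path x1 k (Suc n)"
    using that by (auto simp: arrivals_during_service_def simp del: departure_path.simps(2)
        simp: departure_path.simps(2)[of _ _ "Suc n"])
  then show ?case using Suc.IH by (simp add: atLeastAtMostSuc_conv del: departure_path.simps) blast
qed simp

lemma transition_nonzero_imp_arrivals_nonneg:
  "transition_matrix p (x i) (x (i + 1)) \<noteq> 0 \<Longrightarrow> arrivals_during_service x i \<ge> 0"
  by (auto simp: transition_matrix_def arrivals_during_service_def split: if_splits)

context prob_space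
begin

lemma prob_sums_countable_values:
  fixes Y :: "'a \<Rightarrow> nat"
  assumes [measurable]: "random_variable (count_space UNIV) Y" "Measurable.pred M Q"
  shows "(\<lambda>k. prob {\<omega> \<in> space M. Y \<omega> = k \<and> Q \<omega>}) sums prob {\<omega> \<in> space M. Q \<omega>}"
proof -
  have "(\<lambda>k. prob {\<omega> \<in> space M. Y \<omega> = k \<and> Q \<omega>}) sums prob (\<Union>k. {\<omega> \<in> space M. Y \<omega> = k \<and> Q \<omega>})"
    by (rule finite_measure_UNION) (auto simp: disjoint_family_on_def)
  also have "(\<Union>k. {\<omega> \<in> space M. Y \<omega> = k \<and> Q \<omega>}) = {\<omega> \<in> space M. Q \<omega>}" by auto
  finally show ?thesis .
qed

text \<open>A forbidden transition occurs only along one of countably many finite paths, and each of them has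
probability zero. The paths are encoded as lists to make the countability evident.\<close>

lemma markov_chain_transitions_nonzero:
  assumes chain: "stationary_markov_chain M X K"
  shows "AE \<omega> in M. \<forall>n\<ge>1. K (X n \<omega>) (X (n + 1) \<omega>) \<noteq> 0"
proof -
  have rv [measurable]: "i \<ge> 1 \<Longrightarrow> random_variable (count_space UNIV) (X i)" for i
    using chain unfolding stationary_markov_chain_def by blast
  have "AE \<omega> in M. \<forall>xs n. n \<ge> 1 \<and> K (xs ! n) (xs ! (n + 1)) = 0 \<longrightarrow> \<not> (\<forall>i\<in>{1..n+1}. X i \<omega> = xs ! i)"
  proof (subst AE_all_countable, rule allI, subst AE_all_countable, rule allI)
    fix xs :: "nat list" and n :: nat
    show "AE \<omega> in M. n \<ge> 1 \<and> K (xs ! n) (xs ! (n + 1)) = 0 \<longrightarrow> \<not> (\<forall>i\<in>{1..n+1}. X i \<omega> = xs ! i)"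
    proof (cases "n \<ge> 1 \<and> K (xs ! n) (xs ! (n + 1)) = 0")
      case True
      have ev: "{\<omega> \<in> space M. \<forall>i\<in>{1..n+1}. X i \<omega> = xs ! i} \<in> events" by measurable
      have "prob {\<omega> \<in> space M. \<forall>i\<in>{1..n+1}. X i \<omega> = xs ! i} = 0"
        using chain True unfolding stationary_markov_chain_def by force
      then have "AE \<omega> in M. \<omega> \<notin> {\<omega> \<in> space M. \<forall>i\<in>{1..n+1}. X i \<omega> = xs ! i}"
        using ev by (simp add: prob_eq_0)
      then show ?thesis using AE_space by eventually_elim auto
    qed auto
  qed
  then show ?thesis
  proof eventually_elim
    case (elim \<omega>)
    show ?case
    proof (intro allI impI notI)
      fix n :: nat assume n: "n \<ge> 1" "K (X n \<omega>) (X (n + 1) \<omega>) = 0"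
      define xs where "xs = map (\<lambda>i. X i \<omega>) [0..<n+2]"
      have "xs ! i = X i \<omega>" if "i < n + 2" for i using that by (simp add: xs_def del: upt_Suc)
      then show False using elim[rule_format, of n xs] n by simp
    qed
  qed
qed

text \<open>Along a departure path each transition has the probability \<open>p (k i)\<close>, whatever the current
state is. This cancels the dependence on the past.\<close>

lemma queue_arrivals_path_prob:
  assumes chain: "stationary_markov_chain M X (transition_matrix p)"
  shows "prob {\<omega> \<in> space M. X 1 \<omega> = x1 \<and> (\<forall>i\<in>{1..n}. arrivals_during_service (\<lambda>j. X j \<omega>) i = int (k i))}
    = prob {\<omega> \<in> space M. X 1 \<omega> = x1} * (\<Prod>i\<in>{1..n}. p (k i))"
proof -
  have markov: "prob {\<omega> \<in> space M. \<forall>i\<in>{1..n+1}. X i \<omega> = x i}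
      = prob {\<omega> \<in> space M. \<forall>i\<in>{1..n}. X i \<omega> = x i} * transition_matrix p (x n) (x (n+1))"
    if "n \<ge> 1" for n x
    using chain that unfolding stationary_markov_chain_def by blast
  have "prob {\<omega> \<in> space M. \<forall>i\<in>{1..n+1}. X i \<omega> = departure_path x1 k i}
    = prob {\<omega> \<in> space M. X 1 \<omega> = x1} * (\<Prod>i\<in>{1..n}. p (k i))"
  proof (induction n)
    case (Suc n)
    have "prob {\<omega> \<in> space M. \<forall>i\<in>{1..Suc n+1}. X i \<omega> = departure_path x1 k i}
      = prob {\<omega> \<in> space M. \<forall>i\<in>{1..Suc n}. X i \<omega> = departure_path x1 k i}
        * transition_matrix p (departure_path x1 k (Suc n)) (departure_path x1 k (Suc n + 1))"
      by (rule markov) simp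
    also have "transition_matrix p (departure_path x1 k (Suc n)) (departure_path x1 k (Suc n + 1)) = p (k (Suc n))"
      unfolding Suc_eq_plus1[symmetric] by (rule transition_matrix_departure_path) simp
    also have "prob {\<omega> \<in> space M. \<forall>i\<in>{1..Suc n}. X i \<omega> = departure_path x1 k i}
      = prob {\<omega> \<in> space M. X 1 \<omega> = x1} * (\<Prod>i\<in>{1..n}. p (k i))"
      using Suc.IH unfolding Suc_eq_plus1[symmetric] .
    also have "prob {\<omega> \<in> space M. X 1 \<omega> = x1} * (\<Prod>i\<in>{1..n}. p (k i)) * p (k (Suc n))
      = prob {\<omega> \<in> space M. X 1 \<omega> = x1} * (\<Prod>i\<in>{1..Suc n}. p (k i))"
      by (simp add: prod.nat_ivl_Suc')
    finally show ?case .
  qed simp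
  moreover have "(X 1 \<omega> = x1 \<and> (\<forall>i\<in>{1..n}. arrivals_during_service (\<lambda>j. X j \<omega>) i = int (k i)))
      \<longleftrightarrow> (\<forall>i\<in>{1..n+1}. X i \<omega> = departure_path x1 k i)" for \<omega>
    by (rule arrivals_eq_iff_departure_path)
  ultimately show ?thesis by (simp only:)
qed

text \<open>Summing the path probabilities over the initial state gives the product formula for the first
\<open>n\<close> counts. Summing over the values of single counts then removes their indices one by one and
gives the formula for every finite set of indices, and hence the marginal laws and independence.\<close>

lemma queue_arrivals_iid:
  assumes chain: "stationary_markov_chain M X (transition_matrix p)" and p: "p sums 1"
  defines "Y \<equiv> \<lambda>i \<omega>. nat (arrivals_during_service (\<lambda>j. X j \<omega>) i)"
  shows "AE \<omega> in M. \<forall>i\<ge>1. arrivals_during_service (\<lambda>j. X j \<omega>) i = int (Y i \<omega>)"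
    and "i \<ge> 1 \<Longrightarrow> random_variable (count_space UNIV) (Y i)"
    and "i \<ge> 1 \<Longrightarrow> prob {\<omega> \<in> space M. Y i \<omega> = k} = p k"
    and "indep_vars (\<lambda>_. count_space UNIV) Y {1..}"
proof -
  have rvX [measurable]: "i \<ge> 1 \<Longrightarrow> random_variable (count_space UNIV) (X i)" for i
    using chain unfolding stationary_markov_chain_def by blast
  show ae: "AE \<omega> in M. \<forall>i\<ge>1. arrivals_during_service (\<lambda>j. X j \<omega>) i = int (Y i \<omega>)"
    using markov_chain_transitions_nonzero[OF chain]
  proof eventually_elim
    case (elim \<omega>)
    then have "arrivals_during_service (\<lambda>j. X j \<omega>) i \<ge> 0" if "i \<ge> 1" for i
      using transition_nonzero_imp_arrivals_nonneg[of p "\<lambda>j. X j \<omega>" i] that by simp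
    then show ?case by (simp add: Y_def)
  qed
  have rvZ: "random_variable (count_space UNIV) (\<lambda>\<omega>. arrivals_during_service (\<lambda>j. X j \<omega>) i)" if "i \<ge> 1" for i
    unfolding arrivals_during_service_def
  proof (rule measurable_compose_countable[where g="X i"])
    fix a
    have "random_variable (count_space UNIV) (X (i + 1))" by (rule rvX) simp
    then show "(\<lambda>\<omega>. int (X (i + 1) \<omega>) - int a + (1 - (if a = 0 then 1 else 0))) \<in> measurable M (count_space UNIV)"
      by (rule measurable_compose) simp
  qed (use that in \<open>rule rvX\<close>)
  show rvY: "random_variable (count_space UNIV) (Y i)" if "i \<ge> 1" for i
    unfolding Y_def using rvZ[OF that] by (rule measurable_compose) simp
  note [measurable] = rvY rvZ
  have full: "prob {\<omega> \<in> space M. \<forall>i\<in>{1..n}. Y i \<omega> = k i} = (\<Prod>i\<in>{1..n}. p (k i))" for n k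
  proof -
    have mX [measurable]: "random_variable (count_space UNIV) (X 1)" by (rule rvX) simp
    have mQ [measurable]: "Measurable.pred M (\<lambda>\<omega>. \<forall>i\<in>{1..n}. Y i \<omega> = k i)" by measurable
    have "(\<lambda>x. prob {\<omega> \<in> space M. X 1 \<omega> = x \<and> True}) sums prob {\<omega> \<in> space M. True}"
      by (rule prob_sums_countable_values) simp_all
    then have "(\<lambda>x. prob {\<omega> \<in> space M. X 1 \<omega> = x}) sums 1" by (simp add: prob_space)
    then have 1: "(\<lambda>x. prob {\<omega> \<in> space M. X 1 \<omega> = x} * (\<Prod>i\<in>{1..n}. p (k i))) sums (1 * (\<Prod>i\<in>{1..n}. p (k i)))"
      by (rule sums_mult2)
    have eq: "prob {\<omega> \<in> space M. X 1 \<omega> = x \<and> (\<forall>i\<in>{1..n}. Y i \<omega> = k i)}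
      = prob {\<omega> \<in> space M. X 1 \<omega> = x} * (\<Prod>i\<in>{1..n}. p (k i))" for x
    proof -
      have "prob {\<omega> \<in> space M. X 1 \<omega> = x \<and> (\<forall>i\<in>{1..n}. Y i \<omega> = k i)}
        = prob {\<omega> \<in> space M. X 1 \<omega> = x \<and> (\<forall>i\<in>{1..n}. arrivals_during_service (\<lambda>j. X j \<omega>) i = int (k i))}"
      proof (rule measure_eq_AE)
        show "AE \<omega> in M. (\<omega> \<in> {\<omega> \<in> space M. X 1 \<omega> = x \<and> (\<forall>i\<in>{1..n}. Y i \<omega> = k i)}) =
          (\<omega> \<in> {\<omega> \<in> space M. X 1 \<omega> = x \<and> (\<forall>i\<in>{1..n}. arrivals_during_service (\<lambda>j. X j \<omega>) i = int (k i))})"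
          using ae by eventually_elim auto
        show "{\<omega> \<in> space M. X 1 \<omega> = x \<and> (\<forall>i\<in>{1..n}. Y i \<omega> = k i)} \<in> events" by measurable
        show "{\<omega> \<in> space M. X 1 \<omega> = x \<and> (\<forall>i\<in>{1..n}. arrivals_during_service (\<lambda>j. X j \<omega>) i = int (k i))} \<in> events"
          by measurable
      qed
      then show ?thesis using queue_arrivals_path_prob[OF chain] by simp
    qed
    have "(\<lambda>x. prob {\<omega> \<in> space M. X 1 \<omega> = x \<and> (\<forall>i\<in>{1..n}. Y i \<omega> = k i)})
      sums prob {\<omega> \<in> space M. \<forall>i\<in>{1..n}. Y i \<omega> = k i}"
      by (rule prob_sums_countable_values) (fact mX mQ)+
    then show ?thesis using 1 unfolding eq using sums_unique2 by fastforce
  qed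
  \<comment> \<open>Remove the indices in \<open>D\<close>: summing over the value \<open>c\<close> of count \<open>d\<close> replaces the factor \<open>p (k d)\<close> by \<open>1\<close>.\<close>
  have drop: "prob {\<omega> \<in> space M. \<forall>i\<in>{1..n} - D. Y i \<omega> = k i} = (\<Prod>i\<in>{1..n} - D. p (k i))"
    if "finite D" "D \<subseteq> {1..n}" for n D k
    using that
  proof (induction D arbitrary: k rule: finite_induct)
    case empty
    show ?case using full by simp
  next
    case (insert d D)
    let ?J = "{1..n} - insert d D"
    have J: "{1..n} - D = insert d ?J" "d \<notin> ?J" "finite ?J" "d \<ge> 1" using insert by auto
    have mY: "random_variable (count_space UNIV) (Y d)" using J(4) by (rule rvY)
    have mQ: "Measurable.pred M (\<lambda>\<omega>. \<forall>i\<in>?J. Y i \<omega> = k i)" by measurable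
    have "prob {\<omega> \<in> space M. Y d \<omega> = c \<and> (\<forall>i\<in>?J. Y i \<omega> = k i)} = p c * (\<Prod>i\<in>?J. p (k i))" for c
    proof -
      have "{\<omega> \<in> space M. Y d \<omega> = c \<and> (\<forall>i\<in>?J. Y i \<omega> = k i)} = {\<omega> \<in> space M. \<forall>i\<in>{1..n} - D. Y i \<omega> = (k(d := c)) i}"
        using J(2) unfolding J(1) by auto
      also have "prob \<dots> = (\<Prod>i\<in>{1..n} - D. p ((k(d := c)) i))" using insert by simp
      also have "\<dots> = p c * (\<Prod>i\<in>?J. p (k i))"
        unfolding J(1) prod.insert[OF J(3,2)] by (intro arg_cong2[where f="(*)"] prod.cong) auto
      finally show ?thesis .
    qed
    then have "(\<lambda>c. p c * (\<Prod>i\<in>?J. p (k i))) sums prob {\<omega> \<in> space M. \<forall>i\<in>?J. Y i \<omega> = k i}"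
      using prob_sums_countable_values[OF mY mQ] by simp
    moreover have "(\<lambda>c. p c * (\<Prod>i\<in>?J. p (k i))) sums (1 * (\<Prod>i\<in>?J. p (k i)))"
      using p by (rule sums_mult2)
    ultimately show ?case using sums_unique2 by fastforce
  qed
  have joint: "prob {\<omega> \<in> space M. \<forall>i\<in>J. Y i \<omega> = k i} = (\<Prod>i\<in>J. p (k i))" if J: "finite J" "J \<subseteq> {1..}" for J k
  proof -
    obtain n where n: "J \<subseteq> {..n}" using J(1) finite_nat_iff_bounded_le by blast
    have "J = {1..n} - ({1..n} - J)" using n J(2) by auto
    then show ?thesis using drop[of "{1..n} - J" n k] by simp
  qed
  show marg: "prob {\<omega> \<in> space M. Y i \<omega> = k} = p k" if "i \<ge> 1" for i k
    using joint[of "{i}" "\<lambda>_. k"] that by simp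
  show "indep_vars (\<lambda>_. count_space UNIV) Y {1..}"
  proof (rule indep_vars_countI)
    fix J k assume J: "finite J" "J \<subseteq> {1::nat..}"
    have "(\<Prod>j\<in>J. p (k j)) = (\<Prod>j\<in>J. prob {\<omega> \<in> space M. Y j \<omega> = k j})"
      using J(2) by (intro prod.cong refl marg[symmetric]) auto
    then show "prob {\<omega> \<in> space M. \<forall>j\<in>J. Y j \<omega> = k j} = (\<Prod>j\<in>J. prob {\<omega> \<in> space M. Y j \<omega> = k j})"
      using joint[OF J] by simp
  qed (use rvY in auto)
qed

end

section \<open>Convergence of empirical generating functions\<close>

text \<open>Scheffe's argument: \<open>\<bar>u - v\<bar> = u - v + 2 * max 0 (v - u)\<close>, the first two terms cancel in the limit
by convergence of the totals, and the last one is dominated by \<open>v\<close>.\<close>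

lemma scheffe_series:
  fixes u :: "nat \<Rightarrow> nat \<Rightarrow> real"
  assumes nonneg: "\<And>n k. 0 \<le> u n k" "\<And>k. 0 \<le> v k"
    and summable: "\<And>n. summable (u n)" "summable v"
    and pointwise: "\<And>k. (\<lambda>n. u n k) \<longlonglongrightarrow> v k"
    and total: "(\<lambda>n. suminf (u n)) \<longlonglongrightarrow> suminf v"
  shows "(\<lambda>n. \<Sum>k. \<bar>u n k - v k\<bar>) \<longlonglongrightarrow> 0"
proof -
  define d where "d k n = max 0 (v k - u n k)" for k n
  have bound: "norm (d k n) \<le> v k" for k n using nonneg(1)[of n k] nonneg(2)[of k] by (simp add: d_def)
  have sd: "summable (\<lambda>k. d k n)" for n
    by (rule summable_comparison_test[OF _ summable(2)]) (use bound in auto)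
  have "(\<lambda>n. d k n) \<longlonglongrightarrow> max 0 (v k - v k)" for k
    unfolding d_def by (intro tendsto_intros pointwise)
  then have pw: "(\<lambda>n. d k n) \<longlonglongrightarrow> 0" for k by simp
  have "eventually (\<lambda>(k, n). norm (d k n) \<le> v k) (sequentially \<times>\<^sub>F sequentially)"
    using bound by (intro always_eventually) auto
  from tannerys_theorem[OF pw this summable(2)]
  have "(\<lambda>n. \<Sum>k. d k n) \<longlonglongrightarrow> (\<Sum>k. 0)" by simp
  then have "(\<lambda>n. suminf (u n) - suminf v + 2 * (\<Sum>k. d k n)) \<longlonglongrightarrow> suminf v - suminf v + 2 * (\<Sum>k. 0)"
    by (intro tendsto_intros total)
  moreover have "(\<Sum>k. \<bar>u n k - v k\<bar>) = suminf (u n) - suminf v + 2 * (\<Sum>k. d k n)" for n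
  proof -
    have "(\<lambda>k. u n k - v k + 2 * d k n) sums (suminf (u n) - suminf v + 2 * (\<Sum>k. d k n))"
      using summable(1)[of n] summable(2) sd[of n] by (intro sums_add sums_diff sums_mult summable_sums)
    moreover have "\<bar>u n k - v k\<bar> = u n k - v k + 2 * d k n" for k by (simp add: d_def max_def)
    ultimately show ?thesis by (simp add: sums_iff)
  qed
  ultimately show ?thesis by simp
qed

text \<open>With weights \<open>s ^ k\<close>, the normalised posterior base measure converges to \<open>p\<close> pointwise and in
total mass, because the prior contributes a bounded mass that is divided by \<open>\<alpha> + N\<close>. By Scheffe
it converges in the weighted \<open>\<ell>\<^sup>1\<close> norm, and this norm bounds the difference of the generating
functions at every \<open>w\<close> with \<open>\<bar>w\<bar> \<le> s\<close>. There are \<open>N\<close> increments among \<open>Suc N\<close> observations, so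
the limits are taken along \<open>Suc N\<close>.\<close>

lemma gamma_n_uniform_convergence:
  fixes y :: "nat \<Rightarrow> nat" and p :: "nat \<Rightarrow> real"
  assumes base: "\<And>n k. posterior_base \<alpha> c0 x n k = \<alpha> * pmf c0 k + (\<Sum>i=1..n-1. if y i = k then 1 else 0)"
    and "\<alpha> > 0" and p: "\<And>k. 0 \<le> p k" and s: "0 \<le> s" and conv: "pgfs_converge c0 p s"
    and freq: "\<And>k. (\<lambda>n. (\<Sum>i=1..n. if y i = k then 1 else 0) / n) \<longlonglongrightarrow> p k"
    and moment: "(\<lambda>n. (\<Sum>i=1..n. s ^ y i) / n) \<longlonglongrightarrow> (\<Sum>k. s ^ k * p k)"
    and e: "e > 0"
  shows "eventually (\<lambda>n. \<forall>w. \<bar>w\<bar> \<le> s \<longrightarrow> \<bar>gamma_n \<alpha> c0 x n w - (\<Sum>k. w ^ k * p k)\<bar> < e) sequentially"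
proof -
  have sc: "summable (\<lambda>k. s ^ k * pmf c0 k)" and sp: "summable (\<lambda>k. s ^ k * p k)"
    using conv by (auto simp: pgfs_converge_def)
  define q where "q N k = (\<Sum>i=1..N. if y i = k then 1 else 0 :: real)" for N k
  define r where "r N k = (\<alpha> * pmf c0 k + q N k) / (\<alpha> + real N)" for N k
  have r: "posterior_base \<alpha> c0 x (Suc N) k / (\<alpha> + real (Suc N) - 1) = r N k" for N k
    by (simp add: base r_def q_def)
  have r0: "0 \<le> r N k" for N k
    using \<open>\<alpha> > 0\<close> by (auto simp: r_def q_def intro!: divide_nonneg_nonneg add_nonneg_nonneg sum_nonneg)
  \<comment> \<open>Mixing a sum over the data with a prior term of fixed size does not change the limit of the averages.\<close>
  have mix: "(\<lambda>N. (\<alpha> * c + b N) / (\<alpha> + real N)) \<longlonglongrightarrow> L" if b: "(\<lambda>N. b N / N) \<longlonglongrightarrow> L" for b L c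
  proof -
    have 1: "(\<lambda>N. \<alpha> * c / real N) \<longlonglongrightarrow> 0" "(\<lambda>N. \<alpha> / real N) \<longlonglongrightarrow> 0" by (rule lim_const_over_n)+
    have "(\<lambda>N. (\<alpha> * c / real N + b N / N) / (\<alpha> / real N + 1)) \<longlonglongrightarrow> (0 + L) / (0 + 1)"
      by (intro tendsto_intros 1 b) simp
    moreover have "eventually (\<lambda>N. (\<alpha> * c / real N + b N / N) / (\<alpha> / real N + 1) = (\<alpha> * c + b N) / (\<alpha> + real N)) sequentially"
      using eventually_gt_at_top[of 0]
      by eventually_elim (use \<open>\<alpha> > 0\<close> in \<open>simp add: add_divide_distrib[symmetric] divide_simps\<close>)
    ultimately show ?thesis by (simp add: tendsto_cong)
  qed
  have sums: "(\<lambda>k. s ^ k * r N k) sums ((\<alpha> * (\<Sum>k. s ^ k * pmf c0 k) + (\<Sum>i=1..N. s ^ y i)) / (\<alpha> + real N))" for N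
  proof -
    have "(\<lambda>k. s ^ k * (if y i = k then 1 else 0)) sums (s ^ y i)" for i
      using sums_single[of "y i" "\<lambda>k. s ^ k"] by (simp add: if_distrib eq_commute cong: if_cong)
    then have "(\<lambda>k. \<Sum>i=1..N. s ^ k * (if y i = k then 1 else 0)) sums (\<Sum>i=1..N. s ^ y i)"
      by (intro sums_sum)
    then have "(\<lambda>k. (\<alpha> * (s ^ k * pmf c0 k) + (\<Sum>i=1..N. s ^ k * (if y i = k then 1 else 0))) / (\<alpha> + real N))
      sums ((\<alpha> * (\<Sum>k. s ^ k * pmf c0 k) + (\<Sum>i=1..N. s ^ y i)) / (\<alpha> + real N))"
      using sc by (intro sums_divide sums_add sums_mult summable_sums)
    then show ?thesis by (simp add: r_def q_def sum_distrib_left algebra_simps add_divide_distrib cong: if_cong)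
  qed
  have lim: "(\<lambda>N. \<Sum>k. \<bar>s ^ k * r N k - s ^ k * p k\<bar>) \<longlonglongrightarrow> 0"
  proof (rule scheffe_series)
    show "(\<lambda>N. s ^ k * r N k) \<longlonglongrightarrow> s ^ k * p k" for k
      unfolding r_def by (intro tendsto_intros mix) (use freq[of k] in \<open>simp add: q_def\<close>)
    show "(\<lambda>N. \<Sum>k. s ^ k * r N k) \<longlonglongrightarrow> (\<Sum>k. s ^ k * p k)"
      using mix[OF moment] by (simp only: sums_unique[OF sums, symmetric])
  qed (use s r0 p sp sums in \<open>auto simp: sums_iff\<close>)
  have "eventually (\<lambda>N. (\<Sum>k. \<bar>s ^ k * r N k - s ^ k * p k\<bar>) < e) sequentially"
    using lim e by (rule order_tendstoD(2))
  then have "eventually (\<lambda>N. \<forall>w. \<bar>w\<bar> \<le> s \<longrightarrow> \<bar>gamma_n \<alpha> c0 x (Suc N) w - (\<Sum>k. w ^ k * p k)\<bar> < e) sequentially"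
  proof (rule eventually_mono, intro allI impI)
    fix N w assume N: "(\<Sum>k. \<bar>s ^ k * r N k - s ^ k * p k\<bar>) < e" and w: "\<bar>w\<bar> \<le> s"
    have le: "\<bar>w ^ k * c\<bar> \<le> s ^ k * \<bar>c\<bar>" for k c
      using w by (simp add: abs_mult power_abs mult_right_mono power_mono)
    have s1: "summable (\<lambda>k. s ^ k * r N k)" using sums by (simp add: sums_iff)
    have sw: "summable (\<lambda>k. w ^ k * r N k)" "summable (\<lambda>k. w ^ k * p k)"
      by (rule summable_comparison_test[OF _ s1], use le[of _ "r N _"] r0 in auto)
        (rule summable_comparison_test[OF _ sp], use le[of _ "p _"] p in auto)
    have sd: "summable (\<lambda>k. \<bar>s ^ k * r N k - s ^ k * p k\<bar>)"
    proof (rule summable_comparison_test[OF _ summable_add[OF s1 sp]], intro exI allI impI)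
      fix k show "norm \<bar>s ^ k * r N k - s ^ k * p k\<bar> \<le> s ^ k * r N k + s ^ k * p k"
        using s r0[of N k] p[of k] abs_triangle_ineq4[of "s ^ k * r N k" "s ^ k * p k"] by simp
    qed
    have le': "\<bar>w ^ k * r N k - w ^ k * p k\<bar> \<le> \<bar>s ^ k * r N k - s ^ k * p k\<bar>" for k
      using le[of k "r N k - p k"] s by (simp add: abs_mult right_diff_distrib[symmetric])
    have sa: "summable (\<lambda>k. \<bar>w ^ k * r N k - w ^ k * p k\<bar>)"
      by (rule summable_comparison_test[OF _ sd]) (use le' in auto)
    have "\<bar>gamma_n \<alpha> c0 x (Suc N) w - (\<Sum>k. w ^ k * p k)\<bar> = \<bar>\<Sum>k. w ^ k * r N k - w ^ k * p k\<bar>"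
      unfolding gamma_n_def r using sw by (simp add: suminf_diff)
    also have "\<dots> \<le> (\<Sum>k. \<bar>w ^ k * r N k - w ^ k * p k\<bar>)" using sa by (rule summable_rabs)
    also have "\<dots> \<le> (\<Sum>k. \<bar>s ^ k * r N k - s ^ k * p k\<bar>)" by (intro suminf_le le' sa sd)
    finally show "\<bar>gamma_n \<alpha> c0 x (Suc N) w - (\<Sum>k. w ^ k * p k)\<bar> < e" using N by simp
  qed
  then show ?thesis by (subst (asm) eventually_sequentially_Suc)
qed

text \<open>The strong law gives one null set for each radius \<open>s\<close>. Countably many radii suffice when every
admissible radius lies below one of them. The largest radius, if there is one, has to be among
them, since the generating functions may converge there and nowhere beyond. If there is none,
one element above each rational number is enough.\<close>

lemma countable_cofinal_subset:
  fixes S :: "real set"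
  shows "\<exists>C. countable C \<and> C \<subseteq> S \<and> (\<forall>s\<in>S. \<exists>c\<in>C. s \<le> c)"
proof -
  define g where "g q = (SOME c. c \<in> S \<and> real_of_rat q < c)" for q
  define m where "m = (SOME c. c \<in> S \<and> (\<forall>s\<in>S. s \<le> c))"
  define C where "C = S \<inter> insert m (range g)"
  show ?thesis
  proof (intro exI[of _ C] conjI ballI)
    show "countable C" unfolding C_def by simp
    show "C \<subseteq> S" unfolding C_def by simp
    fix s assume s: "s \<in> S"
    show "\<exists>c\<in>C. s \<le> c"
    proof (cases "\<exists>c. c \<in> S \<and> (\<forall>s\<in>S. s \<le> c)")
      case True
      then have "m \<in> S \<and> (\<forall>s\<in>S. s \<le> m)" unfolding m_def by (rule someI_ex)
      then show ?thesis using s by (auto simp: C_def)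
    next
      case False
      then obtain c where c: "c \<in> S" "s < c" using s by (meson not_le)
      then obtain q where q: "s < real_of_rat q" "real_of_rat q < c" using of_rat_dense by blast
      then have "\<exists>c. c \<in> S \<and> real_of_rat q < c" using c by blast
      then have "g q \<in> S \<and> real_of_rat q < g q" unfolding g_def by (rule someI_ex)
      then have "g q \<in> C" "s \<le> g q" using q by (simp_all add: C_def)
      then show ?thesis by blast
    qed
  qed
qed

section \<open>The arrival law and the service time transform\<close>

text \<open>The term of order \<open>k\<close> of the exponential series is at most its sum. This keeps the Poisson weights
bounded, so they are integrable for every service time law.\<close>

lemma power_over_fact_le_exp:
  assumes "0 \<le> (x::real)" shows "x ^ k / fact k \<le> exp x"
proof -
  have "sum (\<lambda>n. x ^ n /\<^sub>R fact n) {k} \<le> (\<Sum>n. x ^ n /\<^sub>R fact n)"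
    using assms by (intro sum_le_suminf summable_exp_generic) auto
  then show ?thesis by (simp add: exp_def divide_inverse mult.commute)
qed

lemma integrable_poisson_weight:
  assumes "real_distribution G" "AE t in G. t \<ge> 0" "l \<ge> 0"
  shows "integrable G (\<lambda>t. exp (- (l * t)) * (l * t) ^ k)"
proof -
  interpret real_distribution G by fact
  show ?thesis
  proof (rule integrable_const_bound[where B="fact k"])
    show "AE t in G. norm (exp (- (l * t)) * (l * t) ^ k) \<le> fact k"
      using assms(2)
    proof eventually_elim
      case (elim t)
      then have "(l * t) ^ k / fact k \<le> exp (l * t)" using assms(3) by (intro power_over_fact_le_exp) simp
      then show ?case using elim assms(3) by (simp add: exp_minus field_simps)
    qed
  qed simp
qed

lemma arrivals_law_nonneg:
  assumes "AE t in G. t \<ge> 0" "l \<ge> 0"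
  shows "0 \<le> arrivals_law l G k"
  unfolding arrivals_law_def
  by (intro mult_nonneg_nonneg integral_nonneg_AE) (use assms in \<open>auto elim: eventually_mono\<close>)

text \<open>Given a service time \<open>t\<close>, the number of arrivals is Poisson with mean \<open>l * t\<close> and its generating
function at \<open>w\<close> is \<open>exp (- (l * (1 - w) * t))\<close>. Integrating over \<open>t\<close> gives the transform. The
exchange of sum and integral rests on absolute convergence at \<open>s\<close>, which for \<open>s > 1\<close> is a
restriction on the service time law.\<close>

lemma arrivals_law_pgf:
  assumes G: "real_distribution G" "AE t in G. t \<ge> 0" "l \<ge> 0"
    and sum: "summable (\<lambda>k. s ^ k * arrivals_law l G k)" and w: "\<bar>w\<bar> \<le> s"
  shows "(\<lambda>k. w ^ k * arrivals_law l G k) sums laplace_stieltjes G (l * (1 - w))"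
proof -
  define f where "f k t = w ^ k / fact k * (exp (- (l * t)) * (l * t) ^ k)" for k t
  have f: "f k t = exp (- (l * t)) * ((w * l * t) ^ k /\<^sub>R fact k)" for k t
    by (simp add: f_def power_mult_distrib divide_inverse mult_ac)
  have fs: "(\<lambda>k. f k t) sums exp (- (l * (1 - w) * t))" for t
  proof -
    have "(\<lambda>k. f k t) sums (exp (- (l * t)) * exp (w * l * t))"
      unfolding f by (intro sums_mult exp_converges)
    then show ?thesis by (simp add: exp_add[symmetric] algebra_simps)
  qed
  have fn: "summable (\<lambda>k. norm (f k t))" for t
    unfolding f norm_mult by (intro summable_mult summable_norm_exp)
  have fi: "integrable G (f k)" for k
    unfolding f_def by (intro integrable_mult_right integrable_poisson_weight G)
  have "summable (\<lambda>k. \<integral>t. norm (f k t) \<partial>G)"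
  proof -
    have "(\<integral>t. norm (f k t) \<partial>G) = \<bar>w\<bar> ^ k * arrivals_law l G k" for k
    proof -
      have "(\<integral>t. norm (f k t) \<partial>G) = (\<integral>t. (\<bar>w\<bar> ^ k / fact k) * (exp (- (l * t)) * (l * t) ^ k) \<partial>G)"
      proof (rule integral_cong_AE)
        show "AE t in G. norm (f k t) = (\<bar>w\<bar> ^ k / fact k) * (exp (- (l * t)) * (l * t) ^ k)"
          using G(2) by eventually_elim (use G(3) in \<open>simp add: f_def abs_mult power_abs\<close>)
      qed (use fi[of k] integrable_poisson_weight[OF G, of k] in auto)
      then show ?thesis by (simp add: arrivals_law_def)
    qed
    moreover have "summable (\<lambda>k. \<bar>w\<bar> ^ k * arrivals_law l G k)"
      by (rule summable_comparison_test[OF _ sum])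
        (use w arrivals_law_nonneg[OF G(2,3)] in \<open>auto simp: abs_mult intro!: mult_right_mono power_mono\<close>)
    ultimately show ?thesis by simp
  qed
  then have "(\<lambda>k. integral\<^sup>L G (f k)) sums (\<integral>t. (\<Sum>k. f k t) \<partial>G)"
    by (intro sums_integral fi AE_I2 fn)
  moreover have "integral\<^sup>L G (f k) = w ^ k * arrivals_law l G k" for k
    by (simp add: f_def[abs_def] arrivals_law_def)
  ultimately show ?thesis
    using sums_unique[OF fs] by (simp add: laplace_stieltjes_def)
qed

text \<open>Summability has to come first, as the generating function at \<open>1\<close> presupposes it: the Poisson
weights of a fixed \<open>t\<close> have partial sums at most \<open>1\<close>.\<close>

lemma arrivals_law_sums_1:
  assumes G: "real_distribution G" "AE t in G. t \<ge> 0" "l \<ge> 0"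
  shows "arrivals_law l G sums 1"
proof -
  interpret real_distribution G by fact
  have "summable (arrivals_law l G)"
  proof (rule summableI_nonneg_bounded)
    show "(\<Sum>k<n. arrivals_law l G k) \<le> 1" for n
    proof -
      have i: "integrable G (\<lambda>t. 1 / fact k * (exp (- (l * t)) * (l * t) ^ k))" for k
        by (intro integrable_mult_right integrable_poisson_weight G)
      have "(\<Sum>k<n. arrivals_law l G k) = (\<integral>t. (\<Sum>k<n. 1 / fact k * (exp (- (l * t)) * (l * t) ^ k)) \<partial>G)"
        unfolding arrivals_law_def
        by (subst Bochner_Integration.integral_sum[OF i]) (simp only: integral_mult_right_zero)
      also have "\<dots> \<le> (\<integral>t. 1 \<partial>G)"
      proof (rule integral_mono_AE)
        show "AE t in G. (\<Sum>k<n. 1 / fact k * (exp (- (l * t)) * (l * t) ^ k)) \<le> 1"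
          using G(2)
        proof eventually_elim
          case (elim t)
          have "(\<Sum>k<n. (l * t) ^ k /\<^sub>R fact k) \<le> exp (l * t)"
            unfolding exp_def using elim G(3) by (intro sum_le_suminf summable_exp_generic) auto
          then have "exp (- (l * t)) * (\<Sum>k<n. (l * t) ^ k /\<^sub>R fact k) \<le> exp (- (l * t)) * exp (l * t)"
            by (intro mult_left_mono) auto
          then show ?case by (simp add: sum_distrib_left exp_add[symmetric] divide_inverse mult_ac)
        qed
      qed (use i in auto)
      finally show ?thesis using prob_space by simp
    qed
  qed (rule arrivals_law_nonneg[OF G(2,3)])
  then show ?thesis
    using arrivals_law_pgf[OF G, of 1 1] prob_space by (simp add: laplace_stieltjes_def)
qed

text \<open>The transform has to absorb the error in the arrival rate. On the nonnegative half-line it is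
Lipschitz with the mean service time as constant, because \<open>exp (- (x * t))\<close> has slope at most
\<open>t\<close> in \<open>x\<close>.\<close>

lemma laplace_stieltjes_lipschitz:
  assumes G: "real_distribution G" "AE t in G. t \<ge> 0" and int: "integrable G (\<lambda>t. t)"
    and "0 \<le> y" "0 \<le> z"
  shows "\<bar>laplace_stieltjes G y - laplace_stieltjes G z\<bar> \<le> \<bar>y - z\<bar> * (LINT t|G. t)"
proof -
  interpret real_distribution G by fact
  have i: "integrable G (\<lambda>t. exp (- (x * t)))" if "0 \<le> x" for x
    by (rule integrable_const_bound[where B=1]) (use G(2) that in \<open>auto elim: eventually_mono\<close>)
  have ord: "\<bar>exp (- (a * t)) - exp (- (b * t))\<bar> \<le> \<bar>a - b\<bar> * t"
    if "0 \<le> a" "a \<le> b" "0 \<le> t" for a b t :: real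
  proof -
    have "exp (- (a * t)) - exp (- (b * t)) = exp (- (a * t)) * (1 - exp (- ((b - a) * t)))"
      by (simp add: exp_add[symmetric] algebra_simps)
    also have "\<dots> \<le> 1 * ((b - a) * t)"
      using that exp_ge_add_one_self[of "- ((b - a) * t)"] by (intro mult_mono) auto
    finally show ?thesis using that by (simp add: mult_right_mono)
  qed
  have "\<bar>laplace_stieltjes G y - laplace_stieltjes G z\<bar> = \<bar>\<integral>t. exp (- (y * t)) - exp (- (z * t)) \<partial>G\<bar>"
    unfolding laplace_stieltjes_def using i assms(4,5) by simp
  also have "\<dots> \<le> (\<integral>t. \<bar>exp (- (y * t)) - exp (- (z * t))\<bar> \<partial>G)" by (rule integral_abs_bound)
  also have "\<dots> \<le> (\<integral>t. \<bar>y - z\<bar> * t \<partial>G)"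
  proof (rule integral_mono_AE)
    show "AE t in G. \<bar>exp (- (y * t)) - exp (- (z * t))\<bar> \<le> \<bar>y - z\<bar> * t"
      using G(2)
    proof eventually_elim
      case (elim t)
      then show ?case
        using ord[of y z t] ord[of z y t] assms(4,5) by (cases "y \<le> z") (simp_all add: abs_minus_commute)
    qed
  qed (use i assms int in auto)
  finally show ?thesis by simp
qed

section \<open>Consistency of the plug-in estimator\<close>

context prob_space
begin

lemma lambda_bar_consistent:
  assumes "lambda0 > 0"
    and indep: "indep_vars (\<lambda>_. borel) (\<lambda>i \<omega>. interdeparture (\<lambda>j. T j \<omega>) i) {1..}"
    and law: "\<And>i. i \<ge> 1 \<Longrightarrow> distributed M lborel (\<lambda>\<omega>. interdeparture (\<lambda>j. T j \<omega>) i) (exponential_density lambda0)"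
  shows "AE \<omega> in M. (\<lambda>n. lambda_bar a b (\<lambda>i. T i \<omega>) n) \<longlonglongrightarrow> lambda0"
proof -
  let ?D = "\<lambda>i \<omega>. interdeparture (\<lambda>j. T j \<omega>) i"
  have "AE \<omega> in M. (\<lambda>n. (\<Sum>i=1..n. ?D i \<omega>) / n) \<longlonglongrightarrow> expectation (?D 1)"
  proof (rule strong_law_of_large_numbers_from_1[OF indep])
    show "distr M borel (?D i) = distr M borel (?D 1)" if "i \<ge> 1" for i
    proof -
      have "distr M borel (?D j) = density lborel (exponential_density lambda0)" if "j \<ge> 1" for j
      proof -
        have "distr M borel (?D j) = distr M lborel (?D j)" by (rule distr_cong) simp_all
        also have "\<dots> = density lborel (exponential_density lambda0)"
          by (rule distributed_distr_eq_density[OF law[OF that]])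
        finally show ?thesis .
      qed
      then show ?thesis using that by simp
    qed
    show "integrable M (?D 1)"
      using erlang_ith_moment_integrable[of lambda0 "?D 1" 0 1] law[of 1] \<open>lambda0 > 0\<close> by simp
  qed
  moreover have "expectation (?D 1) = 1 / lambda0"
    using exponential_distributed_expectation law[of 1] \<open>lambda0 > 0\<close> by simp
  ultimately have "AE \<omega> in M. (\<lambda>n. (\<Sum>i=1..n. ?D i \<omega>) / n) \<longlonglongrightarrow> 1 / lambda0" by simp
  then show ?thesis
  proof eventually_elim
    case (elim \<omega>)
    have 1: "(\<lambda>n. a / real n) \<longlonglongrightarrow> 0" "(\<lambda>n. b / real n) \<longlonglongrightarrow> 0" by (rule lim_const_over_n)+
    have "(\<lambda>n. (a / real n + 1) / (b / real n + (\<Sum>i=1..n. ?D i \<omega>) / n)) \<longlonglongrightarrow> (0 + 1) / (0 + 1 / lambda0)"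
      by (intro tendsto_intros 1 elim) (use \<open>lambda0 > 0\<close> in simp)
    moreover have "eventually (\<lambda>n. (a / real n + 1) / (b / real n + (\<Sum>i=1..n. ?D i \<omega>) / n)
        = lambda_bar a b (\<lambda>i. T i \<omega>) n) sequentially"
      using eventually_gt_at_top[of 0]
    proof eventually_elim
      case (elim n)
      have "(a / real n + 1) / (b / real n + (\<Sum>i=1..n. ?D i \<omega>) / n)
        = ((a + real n) / real n) / ((b + (\<Sum>i=1..n. ?D i \<omega>)) / real n)"
        using elim by (simp add: add_divide_distrib)
      then show ?case using elim by (simp add: lambda_bar_def posterior_rate_def)
    qed
    ultimately show ?case by (simp add: tendsto_cong)
  qed
qed

text \<open>The strong law yields the limits of the frequencies of all \<open>k\<close> and of the averages of \<open>s ^ Y i\<close>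
for a countable cofinal set of radii \<open>s\<close>. On this single event of probability one the
deterministic convergence lemma applies to a radius \<open>c \<ge> s\<close>, and its conclusion for \<open>c\<close>
contains the one for \<open>s\<close>.\<close>

lemma gamma_n_consistent:
  assumes chain: "stationary_markov_chain M X (transition_matrix p)"
    and p: "\<And>k. 0 \<le> p k" "p sums 1" and "\<alpha> > 0"
  shows "AE \<omega> in M. \<forall>s\<ge>1. pgfs_converge c0 p s \<longrightarrow> (\<forall>e>0. eventually (\<lambda>n. \<forall>w. \<bar>w\<bar> \<le> s \<longrightarrow>
    \<bar>gamma_n \<alpha> c0 (\<lambda>i. X i \<omega>) n w - (\<Sum>k. w ^ k * p k)\<bar> < e) sequentially)"
proof -
  define Y where "Y i \<omega> = nat (arrivals_during_service (\<lambda>j. X j \<omega>) i)" for i \<omega>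
  note iid = queue_arrivals_iid[OF chain p(2), folded Y_def]
  note law = strong_law_nat_valued[OF iid(4), of p, OF iid(3)]
  let ?S = "{s. s \<ge> 1 \<and> pgfs_converge c0 p s}"
  obtain C where C: "countable C" "C \<subseteq> ?S" "\<forall>s\<in>?S. \<exists>c\<in>C. s \<le> c"
    using countable_cofinal_subset[of ?S] by (elim exE conjE) (rule that)
  have "AE \<omega> in M. \<forall>k. (\<lambda>n. (\<Sum>i=1..n. if Y i \<omega> = k then 1 else 0) / n) \<longlonglongrightarrow> p k"
  proof (subst AE_all_countable, rule allI)
    fix k
    have eq: "(\<lambda>j. (if j = k then 1 else 0) * p j) = (\<lambda>j. if j = k then p j else 0)" by auto
    have "summable (\<lambda>j. \<bar>if j = k then 1 else 0\<bar> * p j)"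
      using eq by (simp add: if_distrib[of abs] cong: if_cong)
    then have "AE \<omega> in M. (\<lambda>n. (\<Sum>i=1..n. (\<lambda>j. if j = k then 1 else 0) (Y i \<omega>)) / n) \<longlonglongrightarrow> (\<Sum>j. (if j = k then 1 else 0) * p j)"
      by (intro law) simp_all
    moreover have "(\<Sum>j. (if j = k then 1 else 0) * p j) = p k"
      unfolding eq by (rule sums_unique[OF sums_single, symmetric])
    ultimately show "AE \<omega> in M. (\<lambda>n. (\<Sum>i=1..n. if Y i \<omega> = k then 1 else 0) / n) \<longlonglongrightarrow> p k" by simp
  qed
  moreover have "AE \<omega> in M. \<forall>s\<in>C. (\<lambda>n. (\<Sum>i=1..n. s ^ Y i \<omega>) / n) \<longlonglongrightarrow> (\<Sum>k. s ^ k * p k)"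
  proof (subst AE_ball_countable[OF C(1)], rule ballI)
    fix s assume "s \<in> C"
    then have s: "s \<ge> 1" "pgfs_converge c0 p s" using C(2) by auto
    then show "AE \<omega> in M. (\<lambda>n. (\<Sum>i=1..n. s ^ Y i \<omega>) / n) \<longlonglongrightarrow> (\<Sum>k. s ^ k * p k)"
      by (intro law) (simp_all add: pgfs_converge_def power_abs)
  qed
  ultimately show ?thesis
    using iid(1)
  proof eventually_elim
    case (elim \<omega>)
    have base: "posterior_base \<alpha> c0 (\<lambda>i. X i \<omega>) n k
      = \<alpha> * pmf c0 k + (\<Sum>i=1..n-1. if Y i \<omega> = k then 1 else 0)" for n k
      unfolding posterior_base_def using elim(3)
      by (intro arg_cong2[where f="(+)"] sum.cong refl) (simp add: arrivals_during_service_def)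
    show ?case
    proof (intro allI impI)
      fix s e :: real assume s: "1 \<le> s" "pgfs_converge c0 p s" and e: "0 < e"
      then obtain c where c: "c \<in> C" "s \<le> c" using C(3) by blast
      then have c': "0 \<le> c" "pgfs_converge c0 p c" using C(2) by auto
      have "eventually (\<lambda>n. \<forall>w. \<bar>w\<bar> \<le> c \<longrightarrow>
        \<bar>gamma_n \<alpha> c0 (\<lambda>i. X i \<omega>) n w - (\<Sum>k. w ^ k * p k)\<bar> < e) sequentially"
        using base \<open>\<alpha> > 0\<close> p(1) c' elim(1)[rule_format] elim(2)[rule_format, OF c(1)] e
        by (rule gamma_n_uniform_convergence)
      then show "eventually (\<lambda>n. \<forall>w. \<bar>w\<bar> \<le> s \<longrightarrow>
        \<bar>gamma_n \<alpha> c0 (\<lambda>i. X i \<omega>) n w - (\<Sum>k. w ^ k * p k)\<bar> < e) sequentially"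
        by (rule eventually_mono) (use c(2) in auto)
    qed
  qed
qed

end

text \<open>The event in the posterior probability depends on the data alone, and it is empty when the
supremum of the deviation is smaller than \<open>e\<close>. The intermediate bound \<open>e'\<close> is there because
values smaller than \<open>e\<close> may still have \<open>e\<close> as their supremum.\<close>

lemma posterior_deviation_prob_eq_0:
  assumes "\<And>z. z \<in> Z \<Longrightarrow> \<bar>g_hat a b \<alpha> c0 x t n z - g z\<bar> \<le> e'" "e' < e"
  shows "posterior_deviation_prob a b \<alpha> c0 x t n g Z e = 0"
proof -
  have "(SUP z\<in>Z. ereal \<bar>g_hat a b \<alpha> c0 x t n z - g z\<bar>) \<le> ereal e'"
    using assms(1) by (intro SUP_least) simp
  also have "\<dots> < ereal e" using assms(2) by simp
  finally show ?thesis unfolding posterior_deviation_prob_def by (simp add: not_le[symmetric])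
qed

theorem theorem4p4:
  fixes P :: "'w measure"
    and X :: "nat \<Rightarrow> 'w \<Rightarrow> nat" and T :: "nat \<Rightarrow> 'w \<Rightarrow> real"
    and lambda0 :: real and G0 :: "real measure"
    and a b \<alpha> :: real and c0 :: "nat pmf"
  assumes "lambda0 > 0"
    and "real_distribution G0" and "AE t in G0. t \<ge> 0"
    and "integrable G0 (\<lambda>t. t)" and "lambda0 * (LINT t|G0. t) < 1"
    and "a > 0" and "b > 0" and "\<alpha> > 0"
    and "prob_space P"
    and "\<forall>i\<ge>1. T i \<in> borel_measurable P"
    and "prob_space.indep_vars P (\<lambda>_. borel)
           (\<lambda>i \<omega>. interdeparture (\<lambda>j. T j \<omega>) i) {1..}"
    and "\<forall>i\<ge>1. distributed P lborel
           (\<lambda>\<omega>. interdeparture (\<lambda>j. T j \<omega>) i) (exponential_density lambda0)"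
    and "stationary_markov_chain P X (transition_matrix (arrivals_law lambda0 G0))"
  shows "AE \<omega> in P. \<forall>R>0. \<forall>\<epsilon>>0. \<forall>s\<ge>1. pgfs_converge c0 (arrivals_law lambda0 G0) s \<longrightarrow>
      (\<lambda>n. posterior_deviation_prob a b \<alpha> c0 (\<lambda>i. X i \<omega>) (\<lambda>i. T i \<omega>) n
             (laplace_stieltjes G0)
             {z \<in> {0..R}. \<bar>1 - z / lambda_bar a b (\<lambda>i. T i \<omega>) n\<bar> \<le> s} \<epsilon>)
        \<longlonglongrightarrow> 0 \<and>
      (R < lambda0 * (1 + s) \<longrightarrow>
        (\<lambda>n. posterior_deviation_prob a b \<alpha> c0 (\<lambda>i. X i \<omega>) (\<lambda>i. T i \<omega>) n
               (laplace_stieltjes G0) {0..R} \<epsilon>) \<longlonglongrightarrow> 0)"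
proof -
  interpret prob_space P by fact
  let ?p = "arrivals_law lambda0 G0" and ?g = "laplace_stieltjes G0" and ?m = "LINT t|G0. t"
  have l0: "lambda0 \<ge> 0" using assms(1) by simp
  have p: "0 \<le> ?p k" "?p sums 1" for k
    using arrivals_law_nonneg arrivals_law_sums_1 assms(2,3) l0 by blast+
  have "AE \<omega> in P. (\<lambda>n. lambda_bar a b (\<lambda>i. T i \<omega>) n) \<longlonglongrightarrow> lambda0"
    using assms(1,11,12) by (intro lambda_bar_consistent) auto
  with gamma_n_consistent[OF assms(13) p assms(8), where ?c0.0 = c0] show ?thesis
  proof eventually_elim
    case (elim \<omega>)
    let ?l = "\<lambda>n. lambda_bar a b (\<lambda>i. T i \<omega>) n" and ?ghat = "\<lambda>n. g_hat a b \<alpha> c0 (\<lambda>i. X i \<omega>) (\<lambda>i. T i \<omega>) n"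
    show ?case
    proof (intro allI impI)
      fix R \<epsilon> s :: real assume R: "0 < R" and \<epsilon>: "0 < \<epsilon>" and s: "1 \<le> s" and conv: "pgfs_converge c0 ?p s"
      let ?Z = "\<lambda>n. {z \<in> {0..R}. \<bar>1 - z / ?l n\<bar> \<le> s}"
      let ?prob = "\<lambda>Z n. posterior_deviation_prob a b \<alpha> c0 (\<lambda>i. X i \<omega>) (\<lambda>i. T i \<omega>) n ?g (Z n) \<epsilon>"
      \<comment> \<open>The limiting generating function at \<open>w = 1 - z / ?l n\<close> is the transform at \<open>lambda0 * z / ?l n\<close> instead of \<open>z\<close>. The fact \<open>time\<close> bounds the effect of this displacement.\<close>
      have pgf: "(\<Sum>k. w ^ k * ?p k) = ?g (lambda0 * (1 - w))" if "\<bar>w\<bar> \<le> s" for w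
        using arrivals_law_pgf[OF assms(2,3) l0 _ that] conv by (simp add: pgfs_converge_def sums_iff)
      have pos: "eventually (\<lambda>n. ?l n > 0) sequentially"
        using elim(2) assms(1) by (rule order_tendstoD(1))
      have "(\<lambda>n. R * \<bar>lambda0 / ?l n - 1\<bar> * ?m) \<longlonglongrightarrow> R * \<bar>lambda0 / lambda0 - 1\<bar> * ?m"
        by (intro tendsto_intros elim(2)) (use assms(1) in simp)
      then have "(\<lambda>n. R * \<bar>lambda0 / ?l n - 1\<bar> * ?m) \<longlonglongrightarrow> 0" using assms(1) by simp
      then have time: "eventually (\<lambda>n. R * \<bar>lambda0 / ?l n - 1\<bar> * ?m < \<epsilon> / 4) sequentially"
        by (rule order_tendstoD(2)) (use \<epsilon> in simp)
      have "eventually (\<lambda>n. \<forall>w. \<bar>w\<bar> \<le> s \<longrightarrow>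
          \<bar>gamma_n \<alpha> c0 (\<lambda>i. X i \<omega>) n w - (\<Sum>k. w ^ k * ?p k)\<bar> < \<epsilon> / 4) sequentially"
        using elim(1)[rule_format, OF s conv, of "\<epsilon> / 4"] \<epsilon> by simp
      then have "eventually (\<lambda>n. ?prob ?Z n = 0) sequentially"
        using pos time
      proof eventually_elim
        case (elim n)
        have m0: "0 \<le> ?m" by (rule integral_nonneg_AE) (rule assms(3))
        have "\<bar>?ghat n z - ?g z\<bar> \<le> \<epsilon> / 2" if "z \<in> ?Z n" for z
        proof -
          let ?w = "1 - z / ?l n"
          have z: "0 \<le> z" "z \<le> R" "\<bar>?w\<bar> \<le> s" using that by auto
          have y: "lambda0 * (1 - ?w) = lambda0 * z / ?l n" by simp
          have "\<bar>?ghat n z - ?g (lambda0 * z / ?l n)\<bar> < \<epsilon> / 4"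
            using elim(1)[rule_format, OF z(3)] pgf[OF z(3)] unfolding y by (simp add: g_hat_def)
          moreover have "\<bar>?g (lambda0 * z / ?l n) - ?g z\<bar> \<le> z * \<bar>lambda0 / ?l n - 1\<bar> * ?m"
          proof -
            have "\<bar>lambda0 * z / ?l n - z\<bar> = \<bar>z * (lambda0 / ?l n - 1)\<bar>" by (simp add: algebra_simps)
            also have "\<dots> = z * \<bar>lambda0 / ?l n - 1\<bar>" using z(1) by (simp add: abs_mult)
            moreover have "\<bar>?g (lambda0 * z / ?l n) - ?g z\<bar> \<le> \<bar>lambda0 * z / ?l n - z\<bar> * ?m"
              using z elim(2) l0 by (intro laplace_stieltjes_lipschitz assms) auto
            ultimately show ?thesis by simp
          qed
          moreover have "z * \<bar>lambda0 / ?l n - 1\<bar> * ?m \<le> R * \<bar>lambda0 / ?l n - 1\<bar> * ?m"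
            using z(2) m0 by (intro mult_right_mono) auto
          ultimately show ?thesis using elim(3) by linarith
        qed
        then show ?case by (rule posterior_deviation_prob_eq_0) (use \<epsilon> in auto)
      qed
      then have main: "?prob ?Z \<longlonglongrightarrow> 0" by (rule tendsto_eventually)
      \<comment> \<open>Once \<open>R / ?l n < 1 + s\<close>, every point of the interval satisfies the restriction on the argument.\<close>
      moreover have "?prob (\<lambda>_. {0..R}) \<longlonglongrightarrow> 0" if small: "R < lambda0 * (1 + s)"
      proof -
        have "(\<lambda>n. R / ?l n) \<longlonglongrightarrow> R / lambda0"
          by (intro tendsto_intros elim(2)) (use assms(1) in simp)
        then have "eventually (\<lambda>n. R / ?l n < 1 + s) sequentially"
          by (rule order_tendstoD(2)) (use small assms(1) in \<open>simp add: field_simps\<close>)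
        then have "eventually (\<lambda>n. ?prob ?Z n = ?prob (\<lambda>_. {0..R}) n) sequentially"
          using pos
        proof eventually_elim
          case (elim n)
          have "\<bar>1 - z / ?l n\<bar> \<le> s" if "z \<in> {0..R}" for z
          proof -
            have "0 \<le> z / ?l n" "z / ?l n \<le> R / ?l n"
              using that elim(2) by (auto intro: divide_right_mono)
            then show ?thesis using elim(1) s by linarith
          qed
          then have "?Z n = {0..R}" by blast
          then show ?case by simp
        qed
        with main show ?thesis by (rule Lim_transform_eventually)
      qed
      ultimately show "?prob ?Z \<longlonglongrightarrow> 0 \<and> (R < lambda0 * (1 + s) \<longrightarrow> ?prob (\<lambda>_. {0..R}) \<longlonglongrightarrow> 0)"
        by blast
    qed
  qed
qed

end
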